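(* Let $G$ be a compact and connected Abelian group whose character group $X$ is equipped with a fixed total order compatible with the group structure. Let $(\Omega,\mu)$ be a measure space, $A:\Omega\to\mathrm{Aut}(G)$ a measurable map with $A(u)\in\mathrm{Aut}(G)^+$ for $\mu$-a.e. $u\in\Omega$, and $\Phi$ a locally $\mu$-integrable function on $\Omega$. The Hausdorff operator $\mathcal{H}_{\Phi,A}$ is bounded on $BMO(G)$ if and only if $\Phi\in L^1(\mu)$. In this case, $$\|\mathcal{H}_{\Phi,A}\|_{\mathcal{L}(BMO(G))}\le\|\Phi\|_{L^1(\mu)}.$$
   Context: $G$ carries its normalized Haar measure $\nu$. $X$ is the (discrete, multiplicatively written) group of continuous characters of $G$ with unit character $\mathbf 1$, and $X_+=\{\chi\in X:\chi\ge\mathbf 1\}$. $\mathrm{Aut}(G)$ is the group of topological automorphisms of $G$ with its natural topology. For $A\in\mathrm{Aut}(G)$, $A^*\in\mathrm{Aut}(X)$ is $A^*(\chi)=\chi\circ A$. $\mathrm{Aut}_+(X)$ is the set of $\tau\in\mathrm{Aut}(X)$ with $\tau(X_+)\subset X_+$, and $\mathrm{Aut}(G)^+=\{A\in\mathrm{Aut}(G):A^*\in\mathrm{Aut}_+(X)\}$. $\widehat f(\chi)=\int_G f\overline\chi\,d\nu$. The Hilbert transform $g\mapsto\widetilde g$ on $L^2(G)$ is the bounded linear operator with $\widehat{\widetilde g}(\chi)=-i\,\mathrm{sgn}_{X_+}(\chi)\widehat g(\chi)$, where $\mathrm{sgn}_{X_+}=1$ on $X_+\setminus\{\mathbf 1\}$,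 $0$ at $\mathbf 1$, and $-1$ on $X\setminus X_+$. $BMO(G)=\{f+\widetilde g:f,g\in L^\infty(G)\}$ with norm $\|\varphi\|_{BMO}=\inf\{\|f\|_\infty+\|g\|_\infty:\varphi=f+\widetilde g,\ f,g\in L^\infty(G)\}$. Hausdorff operator: $(\mathcal{H}_{\Phi,A}f)(x)=\int_\Omega\Phi(u)f(A(u)(x))\,d\mu(u)$. That it is bounded on a normed space $Y$ of functions on $G$ means that for each $f\in Y$ the (Lebesgue) integral exists for $\nu$-a.e. $x$ and defines an element of $Y$, and the resulting linear map $Y\to Y$ is bounded. $\mathcal{L}(Y)$ is the space of bounded linear operators on $Y$ with the operator norm.
   Formalization: "Measurable map A" is read as strongly measurable: Borel and, for each continuous f, u ↦ f∘A(u) essentially separably valued on sets of finite measure. Automatic for metrizable G; with Borel measurability alone the claim fails if real-valued measurable cardinals exist. *)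

theory Defs
  imports "HOL-Probability.Probability" "HOL-Algebra.Group"
begin

text \<open>The compact group \<open>G\<close> is a type \<open>'g\<close> of class \<open>topological_ab_group_add\<close> and
  \<open>t2_space\<close>, written additively; compactness and connectedness are assumptions on \<open>UNIV\<close>.
  Elements of function spaces are represented by Borel functions \<open>'g \<Rightarrow> complex\<close>, and equality
  of such elements is equality almost everywhere.\<close>

text \<open>Regularity is part of the definition because the topology need not be second countable.\<close>

definition normalized_haar :: "'g::topological_ab_group_add measure \<Rightarrow> bool" where
  "normalized_haar \<nu> \<longleftrightarrow>
     sets \<nu> = sets borel \<and>
     emeasure \<nu> UNIV = 1 \<and>
     (\<forall>a. \<forall>B\<in>sets borel. emeasure \<nu> ((\<lambda>x. a + x) ` B) = emeasure \<nu> B) \<and>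
     (\<forall>B\<in>sets borel. emeasure \<nu> B = (INF U\<in>{U. open U \<and> B \<subseteq> U}. emeasure \<nu> U)) \<and>
     (\<forall>U. open U \<longrightarrow> emeasure \<nu> U = (SUP K\<in>{K. compact K \<and> K \<subseteq> U}. emeasure \<nu> K))"


section \<open>The ordered character group\<close>

definition characters :: "('g::topological_ab_group_add \<Rightarrow> complex) set" where
  "characters = {\<eta>. continuous_on UNIV \<eta> \<and> (\<forall>x. cmod (\<eta> x) = 1) \<and>
                    (\<forall>x y. \<eta> (x + y) = \<eta> x * \<eta> y)}"

definition char_group :: "('g::topological_ab_group_add \<Rightarrow> complex) monoid" where
  "char_group = \<lparr>carrier = characters, mult = (\<lambda>\<eta> \<psi> x. \<eta> x * \<psi> x), one = (\<lambda>x. 1)\<rparr>"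

text \<open>\<open>(\<eta>, \<psi>) \<in> r\<close> means \<open>\<eta> \<le> \<psi>\<close>.\<close>

definition compatible_total_order ::
    "('g::topological_ab_group_add \<Rightarrow> complex) rel \<Rightarrow> bool" where
  "compatible_total_order r \<longleftrightarrow>
     linear_order_on (carrier char_group) r \<and>
     (\<forall>\<eta>\<in>carrier char_group. \<forall>\<psi>\<in>carrier char_group. \<forall>\<xi>\<in>carrier char_group.
        (\<eta>, \<psi>) \<in> r \<longrightarrow> (\<eta> \<otimes>\<^bsub>char_group\<^esub> \<xi>, \<psi> \<otimes>\<^bsub>char_group\<^esub> \<xi>) \<in> r)"

definition pos_chars ::
    "('g::topological_ab_group_add \<Rightarrow> complex) rel \<Rightarrow> ('g \<Rightarrow> complex) set" where
  "pos_chars r = {\<eta> \<in> carrier char_group. (\<one>\<^bsub>char_group\<^esub>, \<eta>) \<in> r}"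

definition sgn_pos ::
    "('g::topological_ab_group_add \<Rightarrow> complex) rel \<Rightarrow> ('g \<Rightarrow> complex) \<Rightarrow> complex" where
  "sgn_pos r \<eta> = (if \<eta> = \<one>\<^bsub>char_group\<^esub> then 0 else if \<eta> \<in> pos_chars r then 1 else - 1)"


section \<open>Automorphisms\<close>

definition Aut :: "('g::topological_ab_group_add \<Rightarrow> 'g) set" where
  "Aut = {A. bij A \<and> (\<forall>x y. A (x + y) = A x + A y) \<and>
             continuous_on UNIV A \<and> continuous_on UNIV (inv_into UNIV A)}"

text \<open>The natural topology of \<open>Aut(G)\<close>: the compact-open topology for an automorphism and its
  inverse simultaneously.\<close>

definition aut_topology :: "('g::topological_ab_group_add \<Rightarrow> 'g) topology" where
  "aut_topology = topology_generated_by
     ({{A \<in> Aut. A ` K \<subseteq> U} | K U. compact K \<and> open U} \<union>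
      {{A \<in> Aut. inv_into UNIV A ` K \<subseteq> U} | K U. compact K \<and> open U})"

definition aut_borel :: "('g::topological_ab_group_add \<Rightarrow> 'g) measure" where
  "aut_borel = sigma Aut {W. openin aut_topology W}"

text \<open>Measurability of a family \<open>A\<close> of automorphisms is understood in the strong sense of vector
  integration: \<open>A\<close> is Borel measurable, and the maps \<open>u \<mapsto> f \<circ> A u\<close> into \<open>C(G)\<close> with the uniform norm
  are essentially separably valued on sets of finite measure. If \<open>G\<close> is second countable, the
  second condition is automatic (see \<open>strongly_measurable_aut_iff\<close> below). For
  larger \<open>G\<close> it ensures that \<open>(u, x) \<mapsto> f (A u x)\<close> is product measurable up to null sets.
  Borel measurability alone does not provably give this: if some index set carries a diffuse
  probability measure on all its subsets, there are Borel measurable families of automorphisms for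
  which \<open>\<integral> f (A u x) d\<mu>(u)\<close> is not a measurable function of \<open>x\<close>.\<close>

definition strongly_measurable_aut ::
    "'a measure \<Rightarrow> ('a \<Rightarrow> 'g::topological_ab_group_add \<Rightarrow> 'g) \<Rightarrow> bool" where
  "strongly_measurable_aut M A \<longleftrightarrow>
     A \<in> measurable M aut_borel \<and>
     (\<forall>f::'g \<Rightarrow> complex. continuous_on UNIV f \<longrightarrow>
       (\<forall>S\<in>sets M. emeasure M S < \<infinity> \<longrightarrow>
         (\<exists>D. countable D \<and> (\<forall>d\<in>D. continuous_on UNIV d) \<and>
              (AE u in M. u \<in> S \<longrightarrow> (\<forall>\<epsilon>>0. \<exists>d\<in>D. \<forall>x. cmod (f (A u x) - d x) < \<epsilon>)))))"

definition dual_aut :: "('g \<Rightarrow> 'g) \<Rightarrow> ('g \<Rightarrow> complex) \<Rightarrow> 'g \<Rightarrow> complex" where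
  "dual_aut A \<eta> = \<eta> \<circ> A"

definition aut_plus_dual ::
    "('g::topological_ab_group_add \<Rightarrow> complex) rel \<Rightarrow> (('g \<Rightarrow> complex) \<Rightarrow> 'g \<Rightarrow> complex) set" where
  "aut_plus_dual r = {\<tau> \<in> iso char_group char_group. \<tau> ` pos_chars r \<subseteq> pos_chars r}"

definition aut_plus ::
    "('g::topological_ab_group_add \<Rightarrow> complex) rel \<Rightarrow> ('g \<Rightarrow> 'g) set" where
  "aut_plus r = {A \<in> Aut. dual_aut A \<in> aut_plus_dual r}"


section \<open>Hilbert transform and BMO\<close>

definition fourier :: "'g measure \<Rightarrow> ('g \<Rightarrow> complex) \<Rightarrow> ('g \<Rightarrow> complex) \<Rightarrow> complex" where
  "fourier \<nu> f \<eta> = (LINT x|\<nu>. f x * cnj (\<eta> x))"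

definition L2 :: "'g measure \<Rightarrow> ('g \<Rightarrow> complex) set" where
  "L2 \<nu> = {f \<in> borel_measurable \<nu>. integrable \<nu> (\<lambda>x. (cmod (f x))\<^sup>2)}"

definition Linfty :: "'g measure \<Rightarrow> ('g \<Rightarrow> complex) set" where
  "Linfty \<nu> = {f \<in> borel_measurable \<nu>. esssup \<nu> (\<lambda>x. ereal (cmod (f x))) < \<infinity>}"

definition Linfty_norm :: "'g measure \<Rightarrow> ('g \<Rightarrow> complex) \<Rightarrow> real" where
  "Linfty_norm \<nu> f = real_of_ereal (esssup \<nu> (\<lambda>x. ereal (cmod (f x))))"

text \<open>\<open>h\<close> represents the class of the Hilbert transform of \<open>g\<close>, i.e. the element of \<open>L\<^sup>2\<close> with the
  prescribed Fourier coefficients.\<close>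

definition is_hilbert_transform ::
    "'g::topological_ab_group_add measure \<Rightarrow> ('g \<Rightarrow> complex) rel \<Rightarrow>
     ('g \<Rightarrow> complex) \<Rightarrow> ('g \<Rightarrow> complex) \<Rightarrow> bool" where
  "is_hilbert_transform \<nu> r g h \<longleftrightarrow>
     g \<in> L2 \<nu> \<and> h \<in> L2 \<nu> \<and>
     (\<forall>\<eta>\<in>carrier char_group. fourier \<nu> h \<eta> = - \<i> * sgn_pos r \<eta> * fourier \<nu> g \<eta>)"

definition bmo_decomp ::
    "'g::topological_ab_group_add measure \<Rightarrow> ('g \<Rightarrow> complex) rel \<Rightarrow>
     ('g \<Rightarrow> complex) \<Rightarrow> ('g \<Rightarrow> complex) \<Rightarrow> ('g \<Rightarrow> complex) \<Rightarrow> bool" where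
  "bmo_decomp \<nu> r \<phi> f g \<longleftrightarrow>
     f \<in> Linfty \<nu> \<and> g \<in> Linfty \<nu> \<and>
     (\<exists>h. is_hilbert_transform \<nu> r g h \<and> (AE x in \<nu>. \<phi> x = f x + h x))"

definition BMO ::
    "'g::topological_ab_group_add measure \<Rightarrow> ('g \<Rightarrow> complex) rel \<Rightarrow> ('g \<Rightarrow> complex) set" where
  "BMO \<nu> r = {\<phi> \<in> borel_measurable \<nu>. \<exists>f g. bmo_decomp \<nu> r \<phi> f g}"

definition BMO_norm ::
    "'g::topological_ab_group_add measure \<Rightarrow> ('g \<Rightarrow> complex) rel \<Rightarrow> ('g \<Rightarrow> complex) \<Rightarrow> real" where
  "BMO_norm \<nu> r \<phi> = Inf {Linfty_norm \<nu> f + Linfty_norm \<nu> g | f g. bmo_decomp \<nu> r \<phi> f g}"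


section \<open>Hausdorff operators\<close>

text \<open>A bare measure space has no canonical local structure. \<open>\<L>\<close> is the family of measurable
  sets regarded as local: for example all sets of finite measure, or, when \<open>\<Omega>\<close> carries a
  topology, the compact sets.\<close>

definition locally_integrable :: "'a measure \<Rightarrow> 'a set set \<Rightarrow> ('a \<Rightarrow> complex) \<Rightarrow> bool" where
  "locally_integrable M \<L> \<Phi> \<longleftrightarrow>
     \<Phi> \<in> borel_measurable M \<and> \<L> \<subseteq> sets M \<and> (\<forall>K\<in>\<L>. set_integrable M K \<Phi>)"

definition hausdorff ::
    "'a measure \<Rightarrow> ('a \<Rightarrow> complex) \<Rightarrow> ('a \<Rightarrow> 'g \<Rightarrow> 'g) \<Rightarrow> ('g \<Rightarrow> complex) \<Rightarrow> 'g \<Rightarrow> complex" where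
  "hausdorff M \<Phi> A f x = (LINT u|M. \<Phi> u * f (A u x))"

text \<open>\<open>Y\<close> is a space of functions on \<open>G\<close> with norm \<open>N\<close>, modulo equality almost everywhere. The
  third conjunct says that the operator respects this equality. Linearity is inherited from the
  integral.\<close>

definition hausdorff_bounded_on ::
    "'g measure \<Rightarrow> 'a measure \<Rightarrow> ('a \<Rightarrow> complex) \<Rightarrow> ('a \<Rightarrow> 'g \<Rightarrow> 'g) \<Rightarrow>
     ('g \<Rightarrow> complex) set \<Rightarrow> (('g \<Rightarrow> complex) \<Rightarrow> real) \<Rightarrow> bool" where
  "hausdorff_bounded_on \<nu> M \<Phi> A Y N \<longleftrightarrow>
     (\<forall>f\<in>Y. AE x in \<nu>. integrable M (\<lambda>u. \<Phi> u * f (A u x))) \<and>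
     (\<forall>f\<in>Y. \<exists>g\<in>Y. AE x in \<nu>. hausdorff M \<Phi> A f x = g x) \<and>
     (\<forall>f\<in>Y. \<forall>g\<in>Y. (AE x in \<nu>. f x = g x) \<longrightarrow>
        (AE x in \<nu>. hausdorff M \<Phi> A f x = hausdorff M \<Phi> A g x)) \<and>
     (\<exists>C. \<forall>f\<in>Y. N (hausdorff M \<Phi> A f) \<le> C * N f)"

definition hausdorff_op_norm ::
    "'a measure \<Rightarrow> ('a \<Rightarrow> complex) \<Rightarrow> ('a \<Rightarrow> 'g \<Rightarrow> 'g) \<Rightarrow>
     ('g \<Rightarrow> complex) set \<Rightarrow> (('g \<Rightarrow> complex) \<Rightarrow> real) \<Rightarrow> real" where
  "hausdorff_op_norm M \<Phi> A Y N = Sup {N (hausdorff M \<Phi> A f) | f. f \<in> Y \<and> N f \<le> 1}"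


section \<open>Strong and Borel measurability agree on second countable groups\<close>

lemma topspace_aut_topology: "topspace aut_topology = Aut"
proof -
  have "Aut \<in> {{A \<in> Aut. A ` K \<subseteq> U} | K U. compact K \<and> open (U::'a set)}"
    by (rule CollectI, rule exI[of _ "{}"]) auto
  then show ?thesis
    unfolding aut_topology_def topology_generated_by_topspace by blast
qed

lemma space_aut_borel: "space aut_borel = Aut"
  unfolding aut_borel_def
  by (rule space_measure_of) (use openin_subset topspace_aut_topology in blast)

lemma uniformly_separable_continuous:
  assumes "compact (UNIV :: 'g::second_countable_topology set)"
  obtains D :: "('g::second_countable_topology \<Rightarrow> complex) set"
  where "countable D" "\<forall>d\<in>D. continuous_on UNIV d"
    "\<And>f \<epsilon>. continuous_on UNIV f \<Longrightarrow> \<epsilon> > 0 \<Longrightarrow> \<exists>d\<in>D. \<forall>x. cmod (f x - d x) < \<epsilon>"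
proof -
  obtain B :: "'g set set" where B: "countable B" "topological_basis B"
    using ex_countable_basis by blast
  obtain Q :: "complex set" where Q: "countable Q"
      "\<And>X. open X \<Longrightarrow> X \<noteq> {} \<Longrightarrow> \<exists>d\<in>Q. d \<in> X"
    using countable_dense_setE by blast
  define fits where "fits F n f \<longleftrightarrow> continuous_on UNIV f \<and> (\<Union>(b, q)\<in>F. b) = UNIV \<and>
      (\<forall>(b, q)\<in>F. \<forall>x\<in>b. cmod (f x - q) < inverse (Suc n))"
    for F :: "('g set \<times> complex) set" and n :: nat and f :: "'g \<Rightarrow> complex"
  define I where "I = {F. finite F \<and> F \<subseteq> B \<times> Q} \<times> (UNIV :: nat set)"
  define D where "D = (\<lambda>(F, n). SOME f. fits F n f) ` {(F, n) \<in> I. \<exists>f. fits F n f}"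
  have "countable I"
    unfolding I_def using B(1) Q(1) by (auto intro!: countable_SIGMA countable_Collect_finite_subset)
  then have D1: "countable D"
    unfolding D_def by (intro countable_image) (auto intro: countable_subset)
  have D2: "\<forall>d\<in>D. continuous_on UNIV d"
  proof
    fix d assume "d \<in> D"
    then obtain F n where "d = (SOME f. fits F n f)" "\<exists>f. fits F n f"
      unfolding D_def by auto
    then have "fits F n d" by (metis someI_ex)
    then show "continuous_on UNIV d" unfolding fits_def by blast
  qed
  have D3: "\<exists>d\<in>D. \<forall>x. cmod (f x - d x) < \<epsilon>"
    if f: "continuous_on UNIV f" and "\<epsilon> > 0" for f :: "'g \<Rightarrow> complex" and \<epsilon> :: real
  proof -
    obtain n where n: "inverse (real (Suc n)) < \<epsilon> / 2"
      using reals_Archimedean[of "\<epsilon> / 2"] \<open>\<epsilon> > 0\<close> by auto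
    let ?\<delta> = "inverse (real (Suc n))"
    have "\<exists>b q. b \<in> B \<and> q \<in> Q \<and> x \<in> b \<and> (\<forall>y\<in>b. cmod (f y - q) < ?\<delta>)" for x
    proof -
      obtain q where q: "q \<in> Q" "q \<in> ball (f x) ?\<delta>"
        using Q(2)[of "ball (f x) ?\<delta>"] by auto
      have "open (f -` ball q ?\<delta>)"
        using f open_vimage by blast
      moreover have "x \<in> f -` ball q ?\<delta>"
        using q by (simp add: dist_commute)
      ultimately obtain b where "b \<in> B" "x \<in> b" "b \<subseteq> f -` ball q ?\<delta>"
        using topological_basisE[OF B(2)] by metis
      then show ?thesis using q(1)
        by (intro exI[of _ b] exI[of _ q]) (auto simp: dist_norm norm_minus_commute subset_iff)
    qed
    then obtain b q where bq: "\<And>x. b x \<in> B" "\<And>x. q x \<in> Q" "\<And>x. x \<in> b x"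
        "\<And>x y. y \<in> b x \<Longrightarrow> cmod (f y - q x) < ?\<delta>"
      by metis
    have "UNIV \<subseteq> (\<Union>x\<in>UNIV. b x)" using bq(3) by blast
    moreover have "\<And>x. open (b x)" using bq(1) topological_basis_open[OF B(2)] by blast
    ultimately obtain T where T: "finite T" "UNIV \<subseteq> (\<Union>x\<in>T. b x)"
      using compactE_image[OF assms, of UNIV b] by (metis UNIV_I)
    let ?F = "(\<lambda>x. (b x, q x)) ` T"
    have fit: "fits ?F n f"
      unfolding fits_def using f T(2) bq(4) by auto
    have inI: "(?F, n) \<in> I" unfolding I_def using T(1) bq by auto
    define d where "d = (SOME h. fits ?F n h)"
    have "d \<in> D" unfolding D_def d_def using fit inI by force
    moreover have "fits ?F n d" unfolding d_def by (rule someI[where P = "fits ?F n", OF fit])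
    then have d: "\<And>x y. x \<in> T \<Longrightarrow> y \<in> b x \<Longrightarrow> cmod (d y - q x) < ?\<delta>"
      unfolding fits_def by auto
    have "cmod (f y - d y) < \<epsilon>" for y
    proof -
      obtain x where x: "x \<in> T" "y \<in> b x" using T(2) by blast
      have "cmod (f y - d y) \<le> cmod (f y - q x) + cmod (d y - q x)"
        by (metis norm_triangle_ineq4 diff_diff_eq2 diff_add_cancel)
      then show ?thesis using bq(4)[OF x(2)] d[OF x] n by linarith
    qed
    ultimately show ?thesis by blast
  qed
  show ?thesis using that[OF D1 D2 D3] .
qed

lemma strongly_measurable_aut_iff:
  fixes A :: "'a \<Rightarrow> 'g::{topological_ab_group_add, second_countable_topology} \<Rightarrow> 'g"
  assumes "compact (UNIV :: 'g set)"
  shows "strongly_measurable_aut M A \<longleftrightarrow> A \<in> measurable M aut_borel"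
proof
  assume A: "A \<in> measurable M aut_borel"
  obtain D :: "('g \<Rightarrow> complex) set" where D: "countable D" "\<forall>d\<in>D. continuous_on UNIV d"
    "\<And>f \<epsilon>. continuous_on UNIV f \<Longrightarrow> \<epsilon> > 0 \<Longrightarrow> \<exists>d\<in>D. \<forall>x. cmod (f x - d x) < \<epsilon>"
    using uniformly_separable_continuous[OF assms] by blast
  have "continuous_on UNIV (\<lambda>x. f (A u x))"
    if "continuous_on UNIV f" "u \<in> space M" for f :: "'g \<Rightarrow> complex" and u
  proof -
    have "A u \<in> Aut" using measurable_space[OF A that(2)] space_aut_borel by blast
    then have "continuous_on UNIV (A u)" unfolding Aut_def by blast
    then show ?thesis using that(1) by (metis continuous_on_compose2 subset_UNIV)
  qed
  then have "AE u in M. u \<in> S \<longrightarrow> (\<forall>\<epsilon>>0. \<exists>d\<in>D. \<forall>x. cmod (f (A u x) - d x) < \<epsilon>)"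
    if "continuous_on UNIV f" for f :: "'g \<Rightarrow> complex" and S
    using D(3) that by (intro AE_I2) blast
  then show "strongly_measurable_aut M A"
    unfolding strongly_measurable_aut_def using A D(1,2) by blast
qed (simp add: strongly_measurable_aut_def)

end

theory Submission
  imports Defs
begin

text \<open>
  Testing the operator on the constant function \<open>1\<close> shows that \<open>\<Phi>\<close> is integrable whenever the operator
  is bounded. For the converse let \<open>\<Phi>\<close> be integrable, so that \<open>P = \<bar>\<Phi>\<bar> \<mu>\<close> is a finite measure and
  the Hausdorff operator is the average \<open>f \<mapsto> \<integral> s(u) f(A(u) x) dP(u)\<close> with \<open>s = sgn \<Phi>\<close>. Three
  observations give the estimate.

  \<^item> Topological automorphisms preserve Haar measure (\<open>distr_Aut\<close>), so an average does not increase the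
    uniform norm by more than the factor \<open>P(\<Omega>) = \<parallel>\<Phi>\<parallel>\<^sub>1\<close> (\<open>Linfty_avg\<close>), and it maps \<open>L\<^sup>2\<close> to \<open>L\<^sup>2\<close> (\<open>L2_avg\<close>).

  \<^item> By Fubini the Fourier coefficient of the average of \<open>f\<close> at \<open>\<eta>\<close> is the integral of
    \<open>s(u)\<close> times the coefficient of \<open>f\<close> at \<open>\<eta> \<circ> A(u)\<^sup>-\<^sup>1\<close> (\<open>fourier_avg\<close>). As \<open>A(u)\<close> preserves the order,
    the characters \<open>\<eta>\<close> and \<open>\<eta> \<circ> A(u)\<^sup>-\<^sup>1\<close> have the same sign (\<open>sgn_pos_inv_aut_plus\<close>). Hence averages commute
    with the Hilbert transform (\<open>is_hilbert_transform_avg\<close>).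

  \<^item> An average therefore takes a decomposition \<open>\<phi> = f + h\<close>, with \<open>h\<close> the Hilbert transform of \<open>g\<close>, to
    a decomposition of the same kind, and multiplies its cost by at most \<open>\<parallel>\<Phi>\<parallel>\<^sub>1\<close> (\<open>bmo_decomp_avg\<close>).

  The delicate point is the use of Fubini. The group need not be second countable, and then the map
  \<open>(u, x) \<mapsto> A(u) x\<close> need not be measurable from the product \<open>\<sigma>\<close>-algebra to the Borel sets. For continuous
  \<open>f\<close> the strong measurability of \<open>A\<close> makes \<open>f(A(u) x)\<close> a limit of countably valued families
  (\<open>separably_valued_jointly_measurable\<close>). To pass from continuous to Borel functions one uses that
  Haar measure is completion regular: every open set \<open>U\<close> lies between two sets \<open>{f > 0}\<close> and
  \<open>{d > 0}\<close>, with \<open>f\<close> and \<open>d\<close> continuous, that have the same measure (\<open>open_cozero_sandwich\<close>). Here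
  \<open>{f > 0}\<close> exhausts \<open>U\<close> by inner regularity, and \<open>{d > 0}\<close> is \<open>N + U\<close>, where \<open>N\<close> is the group of periods of
  \<open>f\<close>: a compact subset of \<open>N + U\<close> is covered by finitely many translates \<open>n + U\<close>, and each of them
  agrees with \<open>n + {f > 0} = {f > 0}\<close> up to a null set. It follows that the action is measurable
  from the completed product to the Borel sets (\<open>action_measurable\<close>), which is all that Fubini needs.
\<close>

section \<open>Translations of continuous functions on a compact group\<close>

text \<open>The tube lemma, applied to the compact factor in which \<open>x\<close> varies, makes the choice of \<open>V\<close> uniform.\<close>
lemma translation_uniformly_continuous:
  fixes f :: "'g::topological_ab_group_add \<Rightarrow> 'b::metric_space"
  assumes "compact (UNIV :: 'g set)" "continuous_on UNIV f" "e > 0"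
  obtains V where "open V" "0 \<in> V" "\<And>v x. v \<in> V \<Longrightarrow> dist (f (x + v)) (f x) < e"
proof -
  let ?W = "{p. dist (f (snd p + fst p)) (f (snd p)) < e}"
  have c: "continuous_on UNIV (\<lambda>p :: 'g \<times> 'g. f (snd p + fst p))"
    by (rule continuous_on_compose2[OF assms(2)]) (auto intro!: continuous_intros)
  have c': "continuous_on UNIV (\<lambda>p :: 'g \<times> 'g. f (snd p))"
    by (rule continuous_on_compose2[OF assms(2)]) (auto intro!: continuous_intros)
  have "open ?W"
    by (intro open_Collect_less continuous_intros c c')
  moreover have "{0} \<times> UNIV \<subseteq> ?W" using \<open>e > 0\<close> by auto
  ultimately have "\<exists>V. 0 \<in> V \<and> open V \<and> V \<times> UNIV \<subseteq> ?W"
    by (rule Elementary_Topology.tube_lemma[OF assms(1)])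
  then obtain V where V0: "0 \<in> V" "open V" and V: "V \<times> UNIV \<subseteq> ?W" by (elim exE conjE)
  have "dist (f (x + v)) (f x) < e" if "v \<in> V" for v x
    using subsetD[OF V, of "(v, x)"] that by simp
  then show ?thesis using that[OF V0(2,1)] by blast
qed

lemma compact_bdd_range:
  fixes f :: "'g::topological_space \<Rightarrow> real"
  assumes "compact (UNIV :: 'g set)" "continuous_on UNIV f"
  shows "bdd_above (range f)"
  by (rule bounded_imp_bdd_above[OF compact_imp_bounded[OF compact_continuous_image[OF assms(2,1)]]])

text \<open>The invariant pseudometric \<open>(y, z) \<mapsto> osc f (y - z)\<close> measures how far apart two translates of \<open>f\<close>
  are. Its zero set \<open>{v. osc f v = 0}\<close> is the group of periods of \<open>f\<close>.\<close>
definition osc :: "('g::topological_ab_group_add \<Rightarrow> real) \<Rightarrow> 'g \<Rightarrow> real" where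
  "osc f v = (SUP x. \<bar>f (x + v) - f x\<bar>)"

context
  fixes f :: "'g::topological_ab_group_add \<Rightarrow> real"
  assumes comp: "compact (UNIV :: 'g set)" and f: "continuous_on UNIV f"
begin

lemma osc_upper: "\<bar>f (x + v) - f x\<bar> \<le> osc f v"
proof -
  have "continuous_on UNIV (\<lambda>x. \<bar>f (x + v) - f x\<bar>)"
    by (intro continuous_intros f continuous_on_compose2[OF f]) auto
  from compact_bdd_range[OF comp this] show ?thesis
    unfolding osc_def by (intro cSUP_upper) auto
qed

lemma osc_le: "(\<And>x. \<bar>f (x + v) - f x\<bar> \<le> c) \<Longrightarrow> osc f v \<le> c"
  unfolding osc_def by (intro cSUP_least) auto

lemma osc_nonneg: "0 \<le> osc f v"
  using osc_upper[of 0 v] by linarith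

lemma osc_add_le: "osc f (v + w) \<le> osc f v + osc f w"
proof (rule osc_le)
  fix x
  show "\<bar>f (x + (v + w)) - f x\<bar> \<le> osc f v + osc f w"
    using osc_upper[of "x + v" w] osc_upper[of x v] by (simp add: add.assoc)
qed

lemma osc_minus: "osc f (- v) = osc f v"
proof -
  have "osc f (- v) \<le> osc f v" for v
  proof (rule osc_le)
    fix x show "\<bar>f (x + - v) - f x\<bar> \<le> osc f v"
      using osc_upper[of "x - v" v] by (simp add: abs_minus_commute)
  qed
  from this[of v] this[of "- v"] show ?thesis by simp
qed

lemma osc_eq_0_iff: "osc f v = 0 \<longleftrightarrow> (\<forall>x. f (x + v) = f x)"
proof
  show "osc f v = 0 \<Longrightarrow> \<forall>x. f (x + v) = f x"
    using osc_upper by (metis abs_le_zero_iff right_minus_eq)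
  show "\<forall>x. f (x + v) = f x \<Longrightarrow> osc f v = 0"
    using osc_le[of v 0] osc_nonneg[of v] by simp
qed

text \<open>The pseudometric is continuous for the topology of the group, so its Lipschitz functions are too.\<close>
lemma continuous_on_if_osc_Lipschitz:
  assumes h: "\<And>y z. \<bar>h y - h z\<bar> \<le> osc f (y - z)"
  shows "continuous_on UNIV (h :: 'g \<Rightarrow> real)"
  unfolding continuous_on_def
proof (intro ballI tendstoI)
  fix y :: 'g and e :: real assume "e > 0"
  then have "e / 2 > 0" by simp
  from translation_uniformly_continuous[OF comp f this]
  obtain V where V: "open V" "0 \<in> V" "\<And>v x. v \<in> V \<Longrightarrow> dist (f (x + v)) (f x) < e / 2"
    by metis
  have o: "open ((\<lambda>z. z - y) -` V)"
    by (rule open_vimage[OF V(1)]) (intro continuous_intros)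
  have "dist (h z) (h y) < e" if "z \<in> (\<lambda>z. z - y) -` V" for z
  proof -
    have "osc f (z - y) \<le> e / 2"
      using V(3)[of "z - y"] that by (intro osc_le) (auto simp: dist_real_def intro!: less_imp_le)
    then show ?thesis using h[of z y] \<open>e > 0\<close> by (simp add: dist_real_def)
  qed
  then show "\<forall>\<^sub>F z in at y within UNIV. dist (h z) (h y) < e"
    unfolding eventually_at_topological using o V(2)
    by (intro exI[of _ "(\<lambda>z. z - y) -` V"]) auto
qed

lemma osc_diff_abs: "\<bar>osc f y - osc f z\<bar> \<le> osc f (y - z)"
  using osc_add_le[of "y - z" z] osc_add_le[of "z - y" y] osc_minus[of "y - z"] by simp

lemma continuous_osc: "continuous_on UNIV (osc f)"
  by (rule continuous_on_if_osc_Lipschitz) (rule osc_diff_abs)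

text \<open>The function \<open>d\<close> is the distance to the complement of \<open>W\<close> in the pseudometric. By compactness
  the distance is attained, so it vanishes at \<open>y\<close> only if \<open>y\<close> and some point outside \<open>W\<close> differ by a period,
  which is impossible for \<open>y \<in> W\<close>.\<close>
lemma open_periodic_cozero:
  assumes W: "open W" and per: "\<And>y z. osc f (y - z) = 0 \<Longrightarrow> z \<in> W \<Longrightarrow> y \<in> W"
  obtains d :: "'g \<Rightarrow> real" where "continuous_on UNIV d" "W = {y. d y > 0}"
proof (cases "W = UNIV")
  case True
  then show ?thesis using that[of "\<lambda>_. 1"] by simp
next
  case False
  define C where "C = - W"
  have C: "compact C" "C \<noteq> {}"
    unfolding C_def using W False compact_Int_closed[OF comp, of "- W"] by auto
  define d where "d y = (INF z\<in>C. osc f (y - z))" for y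
  have bdd: "bdd_below ((\<lambda>z. osc f (y - z)) ` C)" for y
    by (rule bdd_belowI[of _ 0]) (auto simp: osc_nonneg)
  have "d y \<le> osc f (y - y') + d y'" for y y'
  proof -
    have "d y - osc f (y - y') \<le> osc f (y' - z)" if "z \<in> C" for z
    proof -
      have "d y \<le> osc f (y - z)"
        unfolding d_def by (rule cINF_lower[OF bdd that])
      also have "\<dots> \<le> osc f (y - y') + osc f (y' - z)"
        using osc_add_le[of "y - y'" "y' - z"] by simp
      finally show ?thesis by simp
    qed
    then have "d y - osc f (y - y') \<le> d y'"
      unfolding d_def[of y'] by (intro cINF_greatest C) auto
    then show ?thesis by simp
  qed
  from this this[of y y' for y y'] have "\<bar>d y - d y'\<bar> \<le> osc f (y - y')" for y y'
    using osc_minus[of "y - y'"] by (smt (verit) minus_diff_eq)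
  then have "continuous_on UNIV d" by (rule continuous_on_if_osc_Lipschitz)
  moreover have "d y > 0 \<longleftrightarrow> y \<in> W" for y
  proof
    assume "d y > 0"
    show "y \<in> W"
    proof (rule ccontr)
      assume "y \<notin> W"
      then have "d y \<le> osc f (y - y)"
        unfolding d_def by (intro cINF_lower[OF bdd]) (auto simp: C_def)
      moreover have "osc f 0 = 0" by (simp add: osc_eq_0_iff)
      ultimately show False using \<open>d y > 0\<close> by simp
    qed
  next
    assume y: "y \<in> W"
    have "continuous_on C (\<lambda>z. osc f (y - z))"
      by (rule continuous_on_compose2[OF continuous_osc]) (auto intro!: continuous_intros)
    then obtain z where z: "z \<in> C" "\<And>z'. z' \<in> C \<Longrightarrow> osc f (y - z) \<le> osc f (y - z')"
      using continuous_attains_inf[OF C] by blast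
    then have "osc f (y - z) \<le> d y"
      unfolding d_def by (intro cINF_greatest C)
    moreover have "osc f (y - z) \<noteq> 0"
      using per[of z y] y z(1) osc_minus[of "y - z"] unfolding C_def by auto
    ultimately show "d y > 0" using osc_nonneg[of "y - z"] by simp
  qed
  ultimately show ?thesis by (intro that[of d]) auto
qed

end

lemma urysohn_compact:
  fixes S T :: "'g::t2_space set"
  assumes "compact (UNIV :: 'g set)" "closed S" "closed T" "S \<inter> T = {}"
  obtains f :: "'g \<Rightarrow> real" where "continuous_on UNIV f" "\<And>x. 0 \<le> f x" "\<And>x. f x \<le> 1"
    "\<And>x. x \<in> S \<Longrightarrow> f x = 1" "\<And>x. x \<in> T \<Longrightarrow> f x = 0"
proof -
  have "normal_space (euclidean :: 'g topology)"
  proof (rule compact_Hausdorff_or_regular_imp_normal_space)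
    show "compact_space (euclidean :: 'g topology)"
      using assms(1) by (simp add: compact_space_def)
    show "Hausdorff_space (euclidean :: 'g topology) \<or> regular_space (euclidean :: 'g topology)"
      using hausdorff unfolding Hausdorff_space_def disjnt_def by (metis open_openin)
  qed
  then obtain f where f: "continuous_map euclidean (top_of_set {0..1::real}) f"
      "f ` T \<subseteq> {0}" "f ` S \<subseteq> {1}"
  proof (rule Urysohn_lemma[where S = T and T = S and a = "0::real" and b = 1])
    show "closedin euclidean T" "closedin euclidean S" "disjnt T S"
      using assms by (auto simp: disjnt_def closed_closedin[symmetric])
  qed auto
  have "continuous_on UNIV f" "f x \<in> {0..1}" for x
    using f(1) by (auto simp: continuous_map_in_subtopology)
  with f(2,3) show ?thesis by (intro that[of f]) auto
qed

section \<open>Joint measurability of separably valued families\<close>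

text \<open>Enumerate \<open>D\<close>. For each \<open>n\<close> choose, measurably in \<open>u\<close>, the first member of \<open>D\<close> that is uniformly
  within \<open>1 / (n + 1)\<close> of \<open>K u\<close>. The resulting families take countably many values, so they are
  jointly measurable, and they converge to \<open>K\<close> outside a null set of \<open>u\<close> that does not depend on \<open>x\<close>.\<close>
lemma separably_valued_jointly_measurable:
  fixes K :: "'a \<Rightarrow> 'x \<Rightarrow> 'b::{banach, second_countable_topology}"
  assumes D: "countable D" "\<And>d. d \<in> D \<Longrightarrow> d \<in> borel_measurable N"
    and sep: "AE u in M. \<forall>e>0. \<exists>d\<in>D. \<forall>x. norm (K u x - d x) < e"
    and meas: "\<And>d e. d \<in> D \<Longrightarrow> {u\<in>space M. \<forall>x. norm (K u x - d x) \<le> e} \<in> sets M"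
  shows "\<exists>F\<in>borel_measurable (M \<Otimes>\<^sub>M N). AE u in M. \<forall>x. F (u, x) = K u x"
proof (cases "D = {}")
  case True
  from sep have "AE u in M. \<forall>x. 0 = K u x"
  proof eventually_elim
    case (elim u)
    from elim[rule_format, OF zero_less_one] True show ?case by simp
  qed
  then show ?thesis by (intro bexI[of _ "\<lambda>_. 0"]) simp_all
next
  case False
  define d where "d = from_nat_into D"
  have d: "d i \<in> D" for i
    unfolding d_def using False by (rule from_nat_into)
  have [measurable]: "d i \<in> borel_measurable N" for i
    by (rule D(2)[OF d])
  define k where "k n u = (LEAST i. \<forall>x. norm (K u x - d i x) \<le> inverse (real (Suc n)))" for n u
  have "Measurable.pred M (\<lambda>u. \<forall>x. norm (K u x - d i x) \<le> inverse (real (Suc n)))" for i n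
    using meas[OF d] unfolding pred_def .
  then have [measurable]: "k n \<in> measurable M (count_space UNIV)" for n
    unfolding k_def by (rule measurable_Least)
  have F [measurable]: "(\<lambda>p. d (k n (fst p)) (snd p)) \<in> borel_measurable (M \<Otimes>\<^sub>M N)" for n
    by (rule measurable_compose_countable[where f = "\<lambda>i p. d i (snd p)"]) measurable
  show ?thesis
  proof (rule bexI)
    show "(\<lambda>p. lim (\<lambda>n. d (k n (fst p)) (snd p))) \<in> borel_measurable (M \<Otimes>\<^sub>M N)"
      by (rule borel_measurable_lim_metric) (rule F)
    show "AE u in M. \<forall>x. lim (\<lambda>n. d (k n (fst (u, x))) (snd (u, x))) = K u x"
      using sep
    proof eventually_elim
      fix u assume u: "\<forall>e>0. \<exists>d\<in>D. \<forall>x. norm (K u x - d x) < e"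
      have bound: "norm (K u x - d (k n u) x) \<le> inverse (real (Suc n))" for n x
      proof -
        obtain d' where d': "d' \<in> D" "\<forall>x. norm (K u x - d' x) < inverse (real (Suc n))"
          using u by (meson inverse_positive_iff_positive of_nat_0_less_iff zero_less_Suc)
        obtain i where "d i = d'"
          using d'(1) D(1) from_nat_into_surj unfolding d_def by metis
        then have "\<forall>x. norm (K u x - d i x) \<le> inverse (real (Suc n))"
          using d'(2) by (auto intro: less_imp_le)
        then have "\<forall>x. norm (K u x - d (k n u) x) \<le> inverse (real (Suc n))"
          unfolding k_def by (rule LeastI)
        then show ?thesis by blast
      qed
      have "(\<lambda>n. d (k n u) x) \<longlonglongrightarrow> K u x" for x
      proof (rule Lim_transform2[OF tendsto_const])
        show "(\<lambda>n. K u x - d (k n u) x) \<longlonglongrightarrow> 0"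
          by (rule Lim_null_comparison[OF always_eventually LIMSEQ_inverse_real_of_nat])
            (use bound in blast)
      qed
      then show "\<forall>x. lim (\<lambda>n. d (k n (fst (u, x))) (snd (u, x))) = K u x"
        by (simp add: limI)
    qed
  qed
qed

text \<open>For each \<open>n\<close> finitely many translates of a small neighbourhood of \<open>0\<close> cover the group, and
  by uniform continuity their base points give a \<open>1 / (n + 1)\<close>-net of the translates of \<open>f\<close>.\<close>
lemma translations_separable:
  fixes f :: "'g::topological_ab_group_add \<Rightarrow> real"
  assumes comp: "compact (UNIV :: 'g set)" and f: "continuous_on UNIV f"
  obtains T where "countable T" "\<And>u e. e > 0 \<Longrightarrow> \<exists>t\<in>T. \<forall>x. \<bar>f (u + x) - f (t + x)\<bar> < e"
proof -
  have "\<forall>n. \<exists>T. finite T \<and> (\<forall>u. \<exists>t\<in>T. \<forall>x. \<bar>f (u + x) - f (t + x)\<bar> < inverse (real (Suc n)))"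
    (is "\<forall>n. \<exists>T. ?Q n T")
  proof
    fix n
    have "inverse (real (Suc n)) > 0" by simp
    from translation_uniformly_continuous[OF comp f this]
    obtain V where V: "open V" "0 \<in> V" "\<And>v x. v \<in> V \<Longrightarrow> dist (f (x + v)) (f x) < inverse (real (Suc n))"
      by metis
    have o: "open ((\<lambda>u. u - t) -` V)" for t
      by (rule open_vimage[OF V(1)]) (intro continuous_intros)
    have "UNIV \<subseteq> (\<Union>t\<in>UNIV. (\<lambda>u. u - t) -` V)" using V(2) by auto
    then obtain T where T: "finite T" "UNIV \<subseteq> (\<Union>t\<in>T. (\<lambda>u. u - t) -` V)"
      by (rule compactE_image[OF comp o])
    have "\<exists>t\<in>T. \<forall>x. \<bar>f (u + x) - f (t + x)\<bar> < inverse (real (Suc n))" for u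
    proof -
      obtain t where t: "t \<in> T" "u - t \<in> V" using T(2) by auto
      have "\<bar>f (u + x) - f (t + x)\<bar> < inverse (real (Suc n))" for x
      proof -
        have "t + x + (u - t) = u + x" by (simp add: algebra_simps)
        with V(3)[OF t(2), of "t + x"] show ?thesis by (simp add: dist_real_def)
      qed
      with t(1) show ?thesis by blast
    qed
    with T(1) show "\<exists>T. ?Q n T" by (intro exI[of _ T]) simp
  qed
  then obtain T where "\<forall>n. ?Q n (T n)" by (rule choice[THEN exE])
  then have T: "\<And>n. finite (T n)"
      "\<And>n u. \<exists>t\<in>T n. \<forall>x. \<bar>f (u + x) - f (t + x)\<bar> < inverse (real (Suc n))"
    by simp_all
  show ?thesis
  proof (rule that[of "\<Union>n. T n"])
    show "countable (\<Union>n. T n)" using T(1) by (intro countable_UN) (auto intro: countable_finite)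
    fix u and e :: real assume "e > 0"
    then obtain n where n: "inverse (real (Suc n)) < e" using reals_Archimedean by blast
    from T(2)[of n u] obtain t where t: "t \<in> T n"
        "\<forall>x. \<bar>f (u + x) - f (t + x)\<bar> < inverse (real (Suc n))"
      by (rule bexE)
    then show "\<exists>t\<in>\<Union>n. T n. \<forall>x. \<bar>f (u + x) - f (t + x)\<bar> < e"
      using less_trans[OF spec[OF t(2)] n] by (intro bexI[of _ t]) auto
  qed
qed

text \<open>Uniqueness of Haar measure on continuous functions: integrating \<open>f (u + x)\<close> first over \<open>u\<close> gives
  the integral of \<open>f\<close> for \<open>\<mu>\<close>, and integrating first over \<open>x\<close> gives the one for \<open>\<nu>\<close>. As addition need
  not be measurable for the product \<open>\<sigma>\<close>-algebra, Fubini is applied to the version \<open>F\<close> of \<open>f (u + x)\<close>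
  that the separability of the translates provides.\<close>
lemma invariant_integrals_agree:
  fixes \<mu> \<nu> :: "'g::topological_ab_group_add measure" and f :: "'g \<Rightarrow> real"
  assumes comp: "compact (UNIV :: 'g set)"
    and \<mu>: "prob_space \<mu>" "sets \<mu> = sets borel" "\<And>a. distr \<mu> borel (\<lambda>x. a + x) = \<mu>"
    and \<nu>: "prob_space \<nu>" "sets \<nu> = sets borel" "\<And>a. distr \<nu> borel (\<lambda>x. a + x) = \<nu>"
    and f: "continuous_on UNIV f"
  shows "(LINT x|\<mu>. f x) = (LINT x|\<nu>. f x)"
proof -
  interpret \<mu>: prob_space \<mu> by fact
  interpret \<nu>: prob_space \<nu> by fact
  interpret pair_prob_space \<mu> \<nu> ..
  have sp [simp]: "space \<mu> = UNIV" "space \<nu> = UNIV"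
    using \<mu>(2) \<nu>(2) sets_eq_imp_space_eq space_borel by blast+
  note [measurable_cong] = \<mu>(2) \<nu>(2)
  have f_shift: "continuous_on UNIV (\<lambda>x. f (a + x))" "continuous_on UNIV (\<lambda>x. f (x + a))" for a
    by (auto intro!: continuous_on_compose2[OF f] continuous_intros)
  note [measurable] = borel_measurable_continuous_onI[OF f]
    borel_measurable_continuous_onI[OF f_shift(1)] borel_measurable_continuous_onI[OF f_shift(2)]
  have shift_meas [measurable]: "(\<lambda>x. a + x :: 'g) \<in> borel_measurable borel" for a
    by (intro borel_measurable_continuous_onI continuous_intros)
  have inv: "(LINT x|\<mu>. f (a + x)) = (LINT x|\<mu>. f x)" "(LINT x|\<nu>. f (a + x)) = (LINT x|\<nu>. f x)" for a
    using integral_distr[of "\<lambda>x. a + x" \<mu> borel f] integral_distr[of "\<lambda>x. a + x" \<nu> borel f]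
      \<mu>(3)[of a] \<nu>(3)[of a] by (auto simp: measurable_cong_sets[OF \<mu>(2) refl] measurable_cong_sets[OF \<nu>(2) refl])
  obtain T where T: "countable T" "\<And>u e. e > 0 \<Longrightarrow> \<exists>t\<in>T. \<forall>x. \<bar>f (u + x) - f (t + x)\<bar> < e"
    using translations_separable[OF comp f] by metis
  have "\<exists>F\<in>borel_measurable (\<mu> \<Otimes>\<^sub>M \<nu>). AE u in \<mu>. \<forall>x. F (u, x) = f (u + x)"
  proof (rule separably_valued_jointly_measurable[where D = "(\<lambda>t x. f (t + x)) ` T" and N = \<nu> and M = \<mu> and K = "\<lambda>u x. f (u + x)"])
    show "countable ((\<lambda>t x. f (t + x)) ` T)" using T(1) by simp
    show "d \<in> borel_measurable \<nu>" if "d \<in> (\<lambda>t x. f (t + x)) ` T" for d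
      using that by auto
    show "AE u in \<mu>. \<forall>e>0. \<exists>d\<in>(\<lambda>t x. f (t + x)) ` T. \<forall>x. norm (f (u + x) - d x) < e"
      using T(2) by (intro AE_I2) auto
    show "{u \<in> space \<mu>. \<forall>x. norm (f (u + x) - d x) \<le> e} \<in> sets \<mu>"
      if "d \<in> (\<lambda>t x. f (t + x)) ` T" for d and e :: real
    proof -
      obtain t where d: "d = (\<lambda>x. f (t + x))" using \<open>d \<in> _\<close> by blast
      have "closed {u. \<forall>x. norm (f (u + x) - d x) \<le> e}"
        unfolding d by (intro closed_Collect_all closed_Collect_le continuous_intros f_shift)
      then show ?thesis by (simp add: \<mu>(2))
    qed
  qed
  then obtain F where F [measurable]: "F \<in> borel_measurable (\<mu> \<Otimes>\<^sub>M \<nu>)"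
    and Feq: "AE u in \<mu>. \<forall>x. F (u, x) = f (u + x)"
    by (rule bexE)
  obtain B where B: "\<And>x. \<bar>f x\<bar> \<le> B"
  proof -
    have "bounded (range f)" by (rule compact_imp_bounded[OF compact_continuous_image[OF f comp]])
    then show thesis using that by (auto simp: bounded_real)
  qed
  have "AE p in \<mu> \<Otimes>\<^sub>M \<nu>. norm (F p) \<le> B"
  proof (rule AE_pair_measure)
    show "AE u in \<mu>. AE x in \<nu>. norm (F (u, x)) \<le> B"
      using Feq by eventually_elim (use B in auto)
  qed measurable
  then have int: "integrable (\<mu> \<Otimes>\<^sub>M \<nu>) (case_prod (\<lambda>u x. F (u, x)))"
    by (simp add: integrable_const_bound)
  have "(LINT u|\<mu>. LINT x|\<nu>. F (u, x)) = (LINT u|\<mu>. (LINT x|\<nu>. f x))" (is "?l = _")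
  proof (rule integral_cong_AE)
    show "AE u in \<mu>. (LINT x|\<nu>. F (u, x)) = (LINT x|\<nu>. f x)"
      using Feq by eventually_elim (simp add: inv)
  qed simp_all
  moreover have "(LINT x|\<nu>. LINT u|\<mu>. F (u, x)) = (LINT x|\<nu>. (LINT u|\<mu>. f u))" (is "?r = _")
  proof (rule Bochner_Integration.integral_cong[OF refl])
    fix x
    have "(LINT u|\<mu>. F (u, x)) = (LINT u|\<mu>. f (u + x))"
      by (rule integral_cong_AE) (use Feq in auto)
    then show "(LINT u|\<mu>. F (u, x)) = (LINT u|\<mu>. f u)" using inv(1)[of x] by (simp add: add.commute)
  qed
  moreover have "?r = ?l" by (rule Fubini_integral[OF int])
  moreover have "(LINT u|\<mu>. c) = c" "(LINT x|\<nu>. c) = c" for c :: real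
    by (simp_all only: lebesgue_integral_const \<mu>.prob_space \<nu>.prob_space scaleR_one)
  ultimately show ?thesis by metis
qed

section \<open>Haar measure and automorphisms\<close>

lemma image_translate:
  fixes B :: "'g::ab_group_add set"
  shows "(\<lambda>x. a + x) ` B = (\<lambda>x. - a + x) -` B"
proof (intro Set.set_eqI iffI)
  fix y assume "y \<in> (\<lambda>x. - a + x) -` B"
  then show "y \<in> (\<lambda>x. a + x) ` B" by (intro image_eqI[of _ _ "- a + y"]) auto
qed auto

lemma borel_measurable_translate [measurable]: "(\<lambda>x. a + x :: 'g::topological_ab_group_add) \<in> borel_measurable borel"
  by (intro borel_measurable_continuous_onI continuous_intros)

lemma AutD:
  assumes "A \<in> Aut"
  shows "bij A" "A (x + y) = A x + A y" "continuous_on UNIV A" "inv_into UNIV A \<in> Aut" "inv_into UNIV A (A x) = x" "A (inv_into UNIV A x) = x"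
proof -
  have A: "bij A" "\<And>x y. A (x + y) = A x + A y" "continuous_on UNIV A" "continuous_on UNIV (inv_into UNIV A)"
    using assms unfolding Aut_def by auto
  show i: "inv_into UNIV A (A x) = x" "A (inv_into UNIV A x) = x" for x
    using A(1) by (simp_all add: bij_is_inj bij_is_surj surj_f_inv_f)
  have "inv_into UNIV A (x + y) = inv_into UNIV A x + inv_into UNIV A y" for x y
    using A(2)[of "inv_into UNIV A x" "inv_into UNIV A y"] i by metis
  then show "inv_into UNIV A \<in> Aut"
    unfolding Aut_def using A by (simp add: bij_imp_bij_inv inv_inv_eq)
qed (use assms in \<open>auto simp: Aut_def\<close>)

lemma Aut_borel: "A \<in> Aut \<Longrightarrow> A \<in> borel_measurable borel"
  by (rule borel_measurable_continuous_onI[OF AutD(3)])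

locale compact_haar =
  fixes \<nu> :: "'g::{topological_ab_group_add, t2_space} measure"
  assumes compact_UNIV: "compact (UNIV :: 'g set)"
    and haar: "normalized_haar \<nu>"
begin

lemma sets_haar [measurable_cong]: "sets \<nu> = sets borel"
  by (rule haar[unfolded normalized_haar_def, THEN conjunct1])

lemma emeasure_UNIV: "emeasure \<nu> UNIV = 1"
  by (rule haar[unfolded normalized_haar_def, THEN conjunct2, THEN conjunct1])

lemma emeasure_translate: "B \<in> sets borel \<Longrightarrow> emeasure \<nu> ((\<lambda>x. a + x) ` B) = emeasure \<nu> B"
  by (rule haar[unfolded normalized_haar_def, THEN conjunct2, THEN conjunct2, THEN conjunct1, rule_format])

lemma open_inner_regular:
  "open U \<Longrightarrow> emeasure \<nu> U = (SUP K\<in>{K. compact K \<and> K \<subseteq> U}. emeasure \<nu> K)"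
  by (rule haar[unfolded normalized_haar_def, THEN conjunct2, THEN conjunct2, THEN conjunct2,
    THEN conjunct2, rule_format])

lemma space_haar [simp]: "space \<nu> = UNIV"
  using sets_eq_imp_space_eq[OF sets_haar] by simp

sublocale prob_space \<nu>
  by (rule prob_spaceI) (simp add: emeasure_UNIV)

lemma measurable_haar_iff [simp]: "f \<in> measurable \<nu> N \<longleftrightarrow> f \<in> measurable borel N"
  by (simp add: measurable_cong_sets[OF sets_haar refl])

lemma distr_translate: "distr \<nu> borel (\<lambda>x. a + x) = \<nu>"
proof (rule measure_eqI)
  fix B assume "B \<in> sets (distr \<nu> borel (\<lambda>x. a + x))"
  then have B: "B \<in> sets borel" by simp
  have "(\<lambda>x. a + x) -` B = (\<lambda>x. - a + x) ` B" unfolding image_translate by simp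
  then have "emeasure (distr \<nu> borel (\<lambda>x. a + x)) B = emeasure \<nu> ((\<lambda>x. - a + x) ` B)"
    using B by (subst emeasure_distr) simp_all
  then show "emeasure (distr \<nu> borel (\<lambda>x. a + x)) B = emeasure \<nu> B"
    using emeasure_translate[OF B] by metis
qed (simp add: sets_haar)

lemma distr_Aut_translate:
  assumes A: "A \<in> Aut"
  shows "distr (distr \<nu> borel A) borel (\<lambda>x. a + x) = distr \<nu> borel A"
proof -
  note [measurable] = Aut_borel[OF A]
  have "(\<lambda>x. a + x) \<circ> A = A \<circ> (\<lambda>x. inv_into UNIV A a + x)"
    by (rule ext) (simp add: AutD[OF A])
  then have "distr (distr \<nu> borel A) borel (\<lambda>x. a + x) = distr \<nu> borel (A \<circ> (\<lambda>x. inv_into UNIV A a + x))"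
    by (subst distr_distr) simp_all
  also have "\<dots> = distr (distr \<nu> borel (\<lambda>x. inv_into UNIV A a + x)) borel A"
    by (subst distr_distr) simp_all
  finally show ?thesis by (simp add: distr_translate)
qed

lemma integral_Aut:
  assumes A: "A \<in> Aut" and f: "continuous_on UNIV (f :: 'g \<Rightarrow> real)"
  shows "(LINT x|distr \<nu> borel A. f x) = (LINT x|\<nu>. f x)"
  using invariant_integrals_agree[OF compact_UNIV prob_space_distr _ _ prob_space_axioms sets_haar distr_translate f, of A borel]
    distr_Aut_translate[OF A] Aut_borel[OF A] by simp

text \<open>The image of Haar measure under an automorphism is again invariant, so both have the same
  integrals of continuous functions. A Urysohn function between a compact set and \<open>U\<close> turns this
  into the inequality, by inner regularity.\<close>
lemma emeasure_vimage_Aut_le: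
  assumes A: "A \<in> Aut" and U: "open U"
  shows "emeasure \<nu> (A -` U) \<le> emeasure \<nu> U"
proof -
  have "open (A -` U)" using AutD(3)[OF A] U open_vimage by blast
  moreover have "emeasure \<nu> K \<le> emeasure \<nu> U" if K: "compact K" "K \<subseteq> A -` U" for K
  proof -
    define \<mu> where "\<mu> = distr \<nu> borel A"
    interpret \<mu>: prob_space \<mu>
      unfolding \<mu>_def using Aut_borel[OF A] by (intro prob_space_distr) simp
    have [simp]: "space \<mu> = UNIV" "sets \<mu> = sets borel" unfolding \<mu>_def by simp_all
    have AK: "compact (A ` K)" "A ` K \<subseteq> U"
      using compact_continuous_image[OF continuous_on_subset[OF AutD(3)[OF A]] K(1)] K(2) by auto
    obtain f where f: "continuous_on UNIV f" "\<And>x. 0 \<le> f x" "\<And>x. f x \<le> (1::real)"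
        "\<And>x. x \<in> A ` K \<Longrightarrow> f x = 1" "\<And>x. x \<in> - U \<Longrightarrow> f x = 0"
      using urysohn_compact[OF compact_UNIV compact_imp_closed[OF AK(1)], of "- U"] U AK(2)
      by (metis Compl_disjoint closed_Compl disjoint_eq_subset_Compl double_complement)
    have fm [measurable]: "f \<in> borel_measurable borel" by (rule borel_measurable_continuous_onI[OF f(1)])
    have [measurable]: "U \<in> sets borel" "A ` K \<in> sets borel"
      using U compact_imp_closed[OF AK(1)] by (simp_all add: borel_open borel_closed)
    have "measure \<mu> (A ` K) = (LINT x|\<mu>. indicator (A ` K) x)" by simp
    also have "\<dots> \<le> (LINT x|\<mu>. f x)"
    proof (rule integral_mono)
      show "integrable \<mu> f"
        by (rule \<mu>.integrable_const_bound[of _ 1]) (auto simp: f(2,3) measurable_cong_sets[of \<mu> borel borel borel])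
      show "integrable \<mu> (indicator (A ` K) :: _ \<Rightarrow> real)"
        by (simp add: \<mu>.emeasure_finite less_top[symmetric])
      show "indicator (A ` K) x \<le> f x" for x
        using f(2,4) by (auto simp: indicator_def)
    qed
    also have "\<dots> = (LINT x|\<nu>. f x)" unfolding \<mu>_def by (rule integral_Aut[OF A f(1)])
    also have "\<dots> \<le> (LINT x|\<nu>. indicator U x)"
    proof (rule integral_mono)
      show "integrable \<nu> f"
        by (rule integrable_const_bound[of _ 1]) (auto simp: f(2,3))
      show "integrable \<nu> (indicator U :: _ \<Rightarrow> real)"
        by (simp add: emeasure_finite less_top[symmetric] sets_haar)
      show "f x \<le> indicator U x" for x
        using f(3,5) by (auto simp: indicator_def)
    qed
    also have "\<dots> = measure \<nu> U" by (simp add: sets_haar)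
    finally have "measure \<mu> (A ` K) \<le> measure \<nu> U" .
    moreover have "emeasure \<mu> (A ` K) = emeasure \<nu> K"
    proof -
      have "A -` A ` K = K" using AutD(1)[OF A] by (simp add: bij_is_inj inj_vimage_image_eq)
      then show ?thesis unfolding \<mu>_def using Aut_borel[OF A] by (subst emeasure_distr) simp_all
    qed
    ultimately show ?thesis
      by (simp add: \<mu>.emeasure_eq_measure emeasure_eq_measure[of U] flip: \<open>emeasure \<mu> (A ` K) = emeasure \<nu> K\<close>)
  qed
  ultimately show ?thesis
    by (subst open_inner_regular) (auto intro!: SUP_least)
qed

text \<open>The inequality for the automorphism and for its inverse gives equality on open sets, and these
  determine a finite Borel measure.\<close>
lemma distr_Aut:
  assumes A: "A \<in> Aut"
  shows "distr \<nu> borel A = \<nu>"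
proof (rule measure_eqI_generator_eq[where E = "{U. open U}" and A = "\<lambda>_. UNIV" and \<Omega> = UNIV])
  show "Int_stable {U :: 'g set. open U}" by (auto simp: Int_stable_def)
  show "sets (distr \<nu> borel A) = sigma_sets UNIV {U. open U}" by (simp add: sets_borel)
  show "sets \<nu> = sigma_sets UNIV {U. open U}" by (simp add: sets_haar sets_borel)
  show "emeasure (distr \<nu> borel A) UNIV \<noteq> \<infinity>" for i :: nat
    using Aut_borel[OF A] by (subst emeasure_distr) (simp_all add: emeasure_UNIV)
  show "emeasure (distr \<nu> borel A) U = emeasure \<nu> U" if "U \<in> {U. open U}" for U
  proof -
    from that have U: "open U" by simp
    have o: "open (A -` U)" using AutD(3)[OF A] U open_vimage by blast
    have "inv_into UNIV A -` (A -` U) = U" by (auto simp: AutD[OF A])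
    then have "emeasure \<nu> U \<le> emeasure \<nu> (A -` U)"
      using emeasure_vimage_Aut_le[OF AutD(4)[OF A] o] by simp
    with emeasure_vimage_Aut_le[OF A U] have "emeasure \<nu> (A -` U) = emeasure \<nu> U" by simp
    then show ?thesis using Aut_borel[OF A] U by (subst emeasure_distr) simp_all
  qed
qed auto

lemma AE_vimage_Aut:
  assumes B: "B \<in> Aut" and ae: "AE y in \<nu>. R y"
  shows "AE x in \<nu>. R (B x)"
proof (rule AE_distrD[where M = \<nu> and M' = borel and f = B and P = R])
  show "B \<in> measurable \<nu> borel" using Aut_borel[OF B] by simp
  show "AE y in distr \<nu> borel B. R y" unfolding distr_Aut[OF B] by (rule ae)
qed

section \<open>Completion regularity\<close>

text \<open>Urysohn functions for a sequence of compact subsets whose measures approach that of \<open>U\<close>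
  are added up with weights \<open>2 ^ - n\<close>.\<close>
lemma open_cozero_kernel:
  assumes U: "open U"
  obtains f :: "'g \<Rightarrow> real" where "continuous_on UNIV f" "{x. f x > 0} \<subseteq> U"
    "emeasure \<nu> {x. f x > 0} = emeasure \<nu> U"
proof -
  have "\<exists>g::nat \<Rightarrow> ennreal. range g \<subseteq> emeasure \<nu> ` {K. compact K \<and> K \<subseteq> U} \<and>
      (SUP K\<in>{K. compact K \<and> K \<subseteq> U}. emeasure \<nu> K) = (SUP i. g i)"
    by (rule ennreal_SUP_countable_SUP) auto
  then obtain g :: "nat \<Rightarrow> ennreal" where g: "range g \<subseteq> emeasure \<nu> ` {K. compact K \<and> K \<subseteq> U}"
      "emeasure \<nu> U = (SUP i. g i)"
    using open_inner_regular[OF U] by auto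
  then have "\<forall>n. \<exists>K. compact K \<and> K \<subseteq> U \<and> g n = emeasure \<nu> K" by blast
  then obtain K where "\<forall>n. compact (K n) \<and> K n \<subseteq> U \<and> g n = emeasure \<nu> (K n)"
    by (rule choice[THEN exE])
  then have K: "\<And>n. compact (K n)" "\<And>n. K n \<subseteq> U" "\<And>n. g n = emeasure \<nu> (K n)" by auto
  have "\<forall>n. \<exists>f::'g \<Rightarrow> real. continuous_on UNIV f \<and> (\<forall>x. 0 \<le> f x \<and> f x \<le> 1) \<and>
      (\<forall>x\<in>K n. f x = 1) \<and> (\<forall>x\<in>- U. f x = 0)"
  proof
    fix n
    have "K n \<inter> - U = {}" "closed (- U)" using K(2)[of n] U by auto
    from urysohn_compact[OF compact_UNIV compact_imp_closed[OF K(1)] this(2,1)]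
    obtain f :: "'g \<Rightarrow> real" where "continuous_on UNIV f" "\<And>x. 0 \<le> f x" "\<And>x. f x \<le> 1"
      "\<And>x. x \<in> K n \<Longrightarrow> f x = 1" "\<And>x. x \<in> - U \<Longrightarrow> f x = 0" by metis
    then show "\<exists>f::'g \<Rightarrow> real. continuous_on UNIV f \<and> (\<forall>x. 0 \<le> f x \<and> f x \<le> 1) \<and>
      (\<forall>x\<in>K n. f x = 1) \<and> (\<forall>x\<in>- U. f x = 0)" by (intro exI[of _ f]) auto
  qed
  then obtain h where "\<forall>n. continuous_on UNIV (h n) \<and> (\<forall>x. 0 \<le> h n x \<and> h n x \<le> (1::real)) \<and>
      (\<forall>x\<in>K n. h n x = 1) \<and> (\<forall>x\<in>- U. h n x = 0)"
    by (rule choice[THEN exE])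
  then have h: "\<And>n. continuous_on UNIV (h n)" "\<And>n x. 0 \<le> h n x" "\<And>n x. h n x \<le> 1"
      "\<And>n x. x \<in> K n \<Longrightarrow> h n x = 1" "\<And>n x. x \<notin> U \<Longrightarrow> h n x = 0" by auto
  define t where "t n x = (1/2)^n * h n x" for n x
  have t: "0 \<le> t n x" "norm (t n x) \<le> (1/2)^n" for n x
    unfolding t_def using h(2,3)[of n x] by (auto simp: mult_left_le)
  have sm: "summable (\<lambda>n. (1/2::real)^n)" by (rule summable_geometric) simp
  define f where "f x = (\<Sum>n. t n x)" for x
  have st: "summable (\<lambda>n. t n x)" for x
    by (rule summable_comparison_test'[OF sm]) (rule t(2))
  have "uniform_limit UNIV (\<lambda>n x. \<Sum>i<n. t i x) f sequentially"
    unfolding f_def by (rule Weierstrass_m_test[OF t(2) sm])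
  then have cont: "continuous_on UNIV f"
    by (rule uniform_limit_theorem[rotated])
      (auto simp: t_def intro!: always_eventually continuous_intros h(1))
  have sub: "{x. f x > 0} \<subseteq> U"
  proof
    fix x assume "x \<in> {x. f x > 0}"
    show "x \<in> U"
    proof (rule ccontr)
      assume "x \<notin> U"
      then have "f x = 0" unfolding f_def t_def by (simp add: h(5))
      with \<open>x \<in> {x. f x > 0}\<close> show False by simp
    qed
  qed
  have o: "open {x. f x > 0}" by (intro open_Collect_less continuous_intros cont)
  have "emeasure \<nu> U \<le> emeasure \<nu> {x. f x > 0}"
    unfolding g(2)
  proof (rule SUP_least)
    fix n
    have "f x > 0" if "x \<in> K n" for x
      unfolding f_def by (rule suminf_pos2[OF st t(1), of n]) (simp add: t_def h(4)[OF that])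
    then show "g n \<le> emeasure \<nu> {x. f x > 0}"
      unfolding K(3) using o by (intro emeasure_mono) (auto simp: sets_haar)
  qed
  moreover have "emeasure \<nu> {x. f x > 0} \<le> emeasure \<nu> U"
    using sub U by (intro emeasure_mono) (auto simp: sets_haar)
  ultimately show ?thesis by (intro that[OF cont sub]) simp
qed

text \<open>Completion regularity of Haar measure. Let \<open>V = {f > 0}\<close> be a cozero set of full measure in
  \<open>U\<close>, let \<open>N\<close> be the group of periods of \<open>f\<close>, and \<open>W = N + U\<close>. Then \<open>W\<close> is open and has the periods
  of \<open>f\<close>, so it is a cozero set as well. It exceeds \<open>V\<close> by a null set only, because
  \<open>(n + U) - V = n + (U - V)\<close> is null for every \<open>n \<in> N\<close> and, by inner regularity, only finitely many of
  these sets matter at a time.\<close>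
lemma open_cozero_sandwich:
  assumes U: "open U"
  obtains f d :: "'g \<Rightarrow> real" where "continuous_on UNIV f" "continuous_on UNIV d"
    "{x. f x > 0} \<subseteq> U" "U \<subseteq> {x. d x > 0}" "{x. d x > 0} - {x. f x > 0} \<in> null_sets \<nu>"
proof -
  obtain f :: "'g \<Rightarrow> real" where f: "continuous_on UNIV f" "{x. f x > 0} \<subseteq> U"
      "emeasure \<nu> {x. f x > 0} = emeasure \<nu> U"
    using open_cozero_kernel[OF U] by metis
  define V where "V = {x. f x > 0}"
  have V: "open V" unfolding V_def by (intro open_Collect_less continuous_intros f(1))
  have UV: "U - V \<in> null_sets \<nu>"
    using emeasure_Diff[of \<nu> V U] f(2,3) U V unfolding V_def[symmetric]
    by (auto simp: null_sets_def sets_haar emeasure_finite)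
  define N where "N = {n. osc f n = 0}"
  define W where "W = (\<Union>n\<in>N. (\<lambda>x. n + x) ` U)"
  have oU: "open ((\<lambda>x. n + x) ` U)" for n
    unfolding image_translate by (rule open_vimage[OF U]) (intro continuous_intros)
  have W: "open W" unfolding W_def using oU by blast
  have "y \<in> W" if "osc f (y - z) = 0" "z \<in> W" for y z
  proof -
    obtain n x where nx: "n \<in> N" "x \<in> U" "z = n + x" using \<open>z \<in> W\<close> unfolding W_def by auto
    have "osc f (y - z + n) \<le> osc f (y - z) + osc f n" by (rule osc_add_le[OF compact_UNIV f(1)])
    then have "y - z + n \<in> N"
      using that(1) nx(1) osc_nonneg[OF compact_UNIV f(1), of "y - z + n"] unfolding N_def by simp
    moreover have "y = (y - z + n) + x" using nx(3) by simp
    ultimately show ?thesis unfolding W_def using nx(2) by blast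
  qed
  then obtain d :: "'g \<Rightarrow> real" where d: "continuous_on UNIV d" "W = {y. d y > 0}"
    by (rule open_periodic_cozero[OF compact_UNIV f(1) W])
  have "osc f 0 = 0" by (simp add: osc_eq_0_iff[OF compact_UNIV f(1)])
  then have "(\<lambda>x. 0 + x) ` U \<subseteq> W" unfolding W_def N_def by (intro UN_upper) simp
  then have UW: "U \<subseteq> W" by simp
  have nV: "(\<lambda>x. n + x) ` U - V \<in> null_sets \<nu>" if "n \<in> N" for n
  proof -
    from that have "osc f n = 0" unfolding N_def by simp
    then have "f (x + n) = f x" for x by (simp only: osc_eq_0_iff[OF compact_UNIV f(1)])
    then have "f (n + x) = f x" for x by (simp only: add.commute[of n])
    then have eq: "(\<lambda>x. n + x) ` U - V = (\<lambda>x. n + x) ` (U - V)" unfolding V_def by auto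
    have "U - V \<in> sets borel" using U V by auto
    then have "emeasure \<nu> ((\<lambda>x. n + x) ` U - V) = emeasure \<nu> (U - V)"
      unfolding eq by (rule emeasure_translate)
    also have "\<dots> = 0" using UV by (rule null_setsD1)
    finally show ?thesis
      using oU[of n] V by (intro null_setsI) (auto simp: sets_haar)
  qed
  have "emeasure \<nu> W \<le> emeasure \<nu> V"
    unfolding open_inner_regular[OF W]
  proof (rule SUP_least, clarify)
    fix K assume K: "compact K" "K \<subseteq> W"
    obtain T where T: "T \<subseteq> N" "finite T" "K \<subseteq> (\<Union>n\<in>T. (\<lambda>x. n + x) ` U)"
      by (rule compactE_image[OF K(1) oU K(2)[unfolded W_def]])
    define Z where "Z = (\<Union>n\<in>T. (\<lambda>x. n + x) ` U - V)"
    have null: "Z \<in> null_sets \<nu>"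
      unfolding Z_def using T(1,2) nV by (intro null_sets_UN') (auto intro: countable_finite)
    have Vs: "V \<in> sets \<nu>" using V by (simp add: sets_haar)
    have "K \<subseteq> V \<union> Z" using T(3) unfolding Z_def by blast
    then have "emeasure \<nu> K \<le> emeasure \<nu> (V \<union> Z)"
      using Vs null_setsD2[OF null] by (intro emeasure_mono sets.Un)
    also have "\<dots> = emeasure \<nu> V"
      by (rule emeasure_Un_null_set[OF Vs null])
    finally show "emeasure \<nu> K \<le> emeasure \<nu> V" .
  qed
  then have "emeasure \<nu> W - emeasure \<nu> V = 0"
    by (intro diff_eq_0_ennreal) (simp_all add: less_top[symmetric])
  moreover have "V \<subseteq> W" using UW f(2) V_def by blast
  ultimately have "W - V \<in> null_sets \<nu>"
    using emeasure_Diff[of \<nu> V W] V W by (auto simp: null_sets_def sets_haar)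
  then show ?thesis
    using UW that[OF f(1) d(1) f(2)] unfolding V_def d(2) by simp
qed

end

section \<open>The action of a measurable family of automorphisms\<close>

lemma subbasic_in_aut_borel:
  assumes "compact K" "open U"
  shows "{B \<in> Aut. B ` K \<subseteq> U} \<in> {W. openin aut_topology W}"
  unfolding aut_topology_def using assms by (auto intro!: topology_generated_by_Basis)

lemma open_in_sets_aut_borel: "openin aut_topology W \<Longrightarrow> W \<in> sets aut_borel"
  unfolding aut_borel_def
  by (rule in_measure_of) (use openin_subset topspace_aut_topology in blast)+

text \<open>On a finite measure space strong measurability of \<open>A\<close> takes the following form.\<close>
locale aut_family = compact_haar \<nu> + P: finite_measure P
  for \<nu> :: "'g::{topological_ab_group_add, t2_space} measure" and P :: "'a measure" +
  fixes A :: "'a \<Rightarrow> 'g \<Rightarrow> 'g"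
  assumes A_measurable: "A \<in> measurable P aut_borel"
    and A_separable: "continuous_on UNIV f \<Longrightarrow>
      \<exists>D. countable D \<and> (\<forall>d\<in>D. continuous_on UNIV d) \<and>
        (AE u in P. \<forall>\<epsilon>>0. \<exists>d\<in>D. \<forall>x. cmod (f (A u x) - d x) < \<epsilon>)"
begin

sublocale pair_sigma_finite P \<nu> ..

lemma A_Aut: "u \<in> space P \<Longrightarrow> A u \<in> Aut"
  using measurable_space[OF A_measurable] space_aut_borel by blast

text \<open>An arbitrary, possibly uncountable, union over \<open>x\<close> is harmless here, as each of its members comes
  from an open set of automorphisms.\<close>
lemma vimage_open_evaluation:
  assumes "\<And>x. open (U x)"
  shows "{u \<in> space P. \<exists>x. A u x \<in> U x} \<in> sets P"
proof -
  have "openin aut_topology {B \<in> Aut. B ` {x} \<subseteq> U x}" for x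
    using subbasic_in_aut_borel[of "{x}" "U x"] assms by simp
  then have "openin aut_topology (\<Union>x. {B \<in> Aut. B ` {x} \<subseteq> U x})"
    by (intro openin_Union) auto
  from measurable_sets[OF A_measurable open_in_sets_aut_borel[OF this]]
  have "A -` (\<Union>x. {B \<in> Aut. B ` {x} \<subseteq> U x}) \<inter> space P \<in> sets P" .
  also have "A -` (\<Union>x. {B \<in> Aut. B ` {x} \<subseteq> U x}) \<inter> space P = {u \<in> space P. \<exists>x. A u x \<in> U x}"
    using A_Aut by auto
  finally show ?thesis .
qed

lemma evaluation_measurable [measurable]: "(\<lambda>u. A u x) \<in> measurable P borel"
proof (rule borel_measurableI)
  fix S :: "'g set" assume "open S"
  then have "{u \<in> space P. \<exists>y. A u y \<in> (if y = x then S else {})} \<in> sets P"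
    by (intro vimage_open_evaluation) simp
  also have "{u \<in> space P. \<exists>y. A u y \<in> (if y = x then S else {})} = (\<lambda>u. A u x) -` S \<inter> space P"
    by (auto split: if_splits)
  finally show "(\<lambda>u. A u x) -` S \<inter> space P \<in> sets P" .
qed

lemma AE_Aut: "AE u in P. A u \<in> Aut"
  using A_Aut by (rule AE_I2)

text \<open>This fact and the next are applied to statements about \<open>A (fst p) (snd p)\<close>, whose measurability is
  what has to be shown. A measurable null set containing the exceptions takes their place.\<close>
lemma AE_pair_fst:
  assumes "AE u in P. Q u"
  shows "AE p in P \<Otimes>\<^sub>M \<nu>. Q (fst p)"
proof -
  from assms obtain N where N: "{u \<in> space P. \<not> Q u} \<subseteq> N" "N \<in> null_sets P"
    by (auto elim: AE_E simp: null_sets_def)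
  have [measurable]: "N \<in> sets P" using N(2) by (rule null_setsD2)
  have "AE p in P \<Otimes>\<^sub>M \<nu>. fst p \<notin> N"
  proof (rule AE_pair_measure)
    show "AE u in P. AE x in \<nu>. fst (u, x) \<notin> N"
      using AE_not_in[OF N(2)] by simp
  qed measurable
  with AE_space show ?thesis
    by eventually_elim (use N(1) in \<open>auto simp: space_pair_measure\<close>)
qed

lemma AE_pair_swap:
  assumes "AE p in P \<Otimes>\<^sub>M \<nu>. Q p"
  shows "AE x in \<nu>. AE u in P. Q (u, x)"
proof -
  from assms obtain N where N: "{p \<in> space (P \<Otimes>\<^sub>M \<nu>). \<not> Q p} \<subseteq> N" "N \<in> null_sets (P \<Otimes>\<^sub>M \<nu>)"
    by (auto elim: AE_E simp: null_sets_def)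
  have [measurable]: "N \<in> sets (P \<Otimes>\<^sub>M \<nu>)" using N(2) by (rule null_setsD2)
  have "AE u in P. AE x in \<nu>. (u, x) \<notin> N"
    using AE_pair[OF AE_not_in[OF N(2)]] .
  then have "AE x in \<nu>. AE u in P. (u, x) \<notin> N"
    by (subst AE_commute[symmetric]) simp_all
  then show ?thesis
  proof eventually_elim
    case (elim x)
    with AE_space show ?case
      by eventually_elim (use N(1) in \<open>auto simp: space_pair_measure\<close>)
  qed
qed

text \<open>The set of \<open>u\<close> with \<open>f \<circ> A u\<close> uniformly within \<open>e\<close> of \<open>d\<close> is the complement of a union of
  open conditions on the values \<open>A u x\<close>, hence measurable.\<close>
lemma continuous_pullback:
  fixes f :: "'g \<Rightarrow> complex"
  assumes f: "continuous_on UNIV f"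
  shows "\<exists>F\<in>borel_measurable (P \<Otimes>\<^sub>M \<nu>). AE u in P. \<forall>x. F (u, x) = f (A u x)"
proof -
  obtain D where D: "countable D" "\<And>d. d \<in> D \<Longrightarrow> continuous_on UNIV d"
      "AE u in P. \<forall>\<epsilon>>0. \<exists>d\<in>D. \<forall>x. cmod (f (A u x) - d x) < \<epsilon>"
    using A_separable[OF f] by blast
  show ?thesis
  proof (rule separably_valued_jointly_measurable[OF D(1) _ D(3)])
    show "d \<in> borel_measurable \<nu>" if "d \<in> D" for d
      using borel_measurable_continuous_onI[OF D(2)[OF that]] by simp
    show "{u \<in> space P. \<forall>x. cmod (f (A u x) - d x) \<le> e} \<in> sets P" if "d \<in> D" for d e
    proof -
      have "open {y. e < cmod (f y - d x)}" for x
        by (intro open_Collect_less continuous_intros f)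
      from sets.compl_sets[OF vimage_open_evaluation[OF this]]
      show ?thesis by (simp add: set_diff_eq not_less cong: conj_cong)
    qed
  qed
qed

text \<open>For open \<open>S\<close>, sandwiched between \<open>{f > 0}\<close> and \<open>{d > 0}\<close>, the preimage of \<open>S\<close> agrees with the
  preimage of \<open>{f > 0}\<close> up to the preimage of \<open>{d > 0} - {f > 0}\<close>. The latter is null by Fubini, because
  every \<open>A u\<close> preserves Haar measure.\<close>
lemma action_measurable: "(\<lambda>p. A (fst p) (snd p)) \<in> measurable (completion (P \<Otimes>\<^sub>M \<nu>)) borel"
proof (rule borel_measurableI)
  fix S :: "'g set" assume "open S"
  then obtain f d :: "'g \<Rightarrow> real" where f: "continuous_on UNIV f" and d: "continuous_on UNIV d"
    and fd: "{x. f x > 0} \<subseteq> S" "S \<subseteq> {x. d x > 0}" "{x. d x > 0} - {x. f x > 0} \<in> null_sets \<nu>"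
    by (rule open_cozero_sandwich)
  have "continuous_on UNIV (\<lambda>x. complex_of_real (f x))" "continuous_on UNIV (\<lambda>x. complex_of_real (d x))"
    by (intro continuous_intros f d)+
  note pb = this[THEN continuous_pullback]
  from pb(1) obtain F where [measurable]: "F \<in> borel_measurable (P \<Otimes>\<^sub>M \<nu>)"
    and F: "AE u in P. \<forall>x. F (u, x) = complex_of_real (f (A u x))" by (rule bexE)
  from pb(2) obtain E where [measurable]: "E \<in> borel_measurable (P \<Otimes>\<^sub>M \<nu>)"
    and E: "AE u in P. \<forall>x. E (u, x) = complex_of_real (d (A u x))" by (rule bexE)
  have "AE p in P \<Otimes>\<^sub>M \<nu>. \<not> (Re (E p) > 0 \<and> \<not> Re (F p) > 0)"
  proof (rule AE_pair_measure)
    show "AE u in P. AE x in \<nu>. \<not> (Re (E (u, x)) > 0 \<and> \<not> Re (F (u, x)) > 0)"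
      using F E AE_Aut
    proof eventually_elim
      case (elim u)
      from AE_vimage_Aut[OF elim(3) AE_not_in[OF fd(3)]]
      show ?case by eventually_elim (simp add: elim(1,2))
    qed
  qed measurable
  moreover note AE_pair_fst[OF F] AE_pair_fst[OF E]
  ultimately have ae: "AE p in P \<Otimes>\<^sub>M \<nu>. p \<in> {p \<in> space (P \<Otimes>\<^sub>M \<nu>). Re (F p) > 0} \<longleftrightarrow>
      p \<in> (\<lambda>p. A (fst p) (snd p)) -` S \<inter> space (P \<Otimes>\<^sub>M \<nu>)"
  proof eventually_elim
    case (elim p)
    have "F p = complex_of_real (f (A (fst p) (snd p)))" "E p = complex_of_real (d (A (fst p) (snd p)))"
      using elim(2)[rule_format, of "snd p"] elim(3)[rule_format, of "snd p"] by simp_all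
    with elim(1) fd(1,2) show ?case by auto
  qed
  show "(\<lambda>p. A (fst p) (snd p)) -` S \<inter> space (completion (P \<Otimes>\<^sub>M \<nu>)) \<in> sets (completion (P \<Otimes>\<^sub>M \<nu>))"
    unfolding space_completion
    by (rule completion.in_sets_AE[OF AE_completion[OF ae]])
      (auto simp: space_completion intro!: sets_completionI_sets)
qed

text \<open>The jointly measurable version of \<open>f (A u x)\<close> to which Fubini can be applied.\<close>
lemma borel_pullback:
  fixes f :: "'g \<Rightarrow> complex"
  assumes f: "f \<in> borel_measurable borel"
  obtains F where "F \<in> borel_measurable (P \<Otimes>\<^sub>M \<nu>)"
    "AE u in P. AE x in \<nu>. F (u, x) = f (A u x)" "AE x in \<nu>. AE u in P. F (u, x) = f (A u x)"
proof -
  have "(\<lambda>p. f (A (fst p) (snd p))) \<in> borel_measurable (completion (P \<Otimes>\<^sub>M \<nu>))"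
    by (rule measurable_compose[OF action_measurable f])
  then have "(\<lambda>p. Re (f (A (fst p) (snd p)))) \<in> borel_measurable (completion (P \<Otimes>\<^sub>M \<nu>))"
    "(\<lambda>p. Im (f (A (fst p) (snd p)))) \<in> borel_measurable (completion (P \<Otimes>\<^sub>M \<nu>))"
    by measurable
  from this[THEN completion_ex_borel_measurable_real] obtain G H
    where [measurable]: "G \<in> borel_measurable (P \<Otimes>\<^sub>M \<nu>)" "H \<in> borel_measurable (P \<Otimes>\<^sub>M \<nu>)"
      and GH: "AE p in P \<Otimes>\<^sub>M \<nu>. Re (f (A (fst p) (snd p))) = G p" "AE p in P \<Otimes>\<^sub>M \<nu>. Im (f (A (fst p) (snd p))) = H p"
    by blast
  from GH have "AE p in P \<Otimes>\<^sub>M \<nu>. Complex (G p) (H p) = f (A (fst p) (snd p))"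
    by eventually_elim (metis complex_surj)
  moreover have "(\<lambda>p. Complex (G p) (H p)) \<in> borel_measurable (P \<Otimes>\<^sub>M \<nu>)"
    unfolding Complex_eq by measurable
  ultimately show ?thesis
    using that[of "\<lambda>p. Complex (G p) (H p)"] AE_pair AE_pair_swap by fastforce
qed

text \<open>The sections in \<open>u\<close> are null for almost every \<open>u\<close> since \<open>A u\<close> preserves Haar measure. Fubini
  exchanges the quantifiers. In particular averages respect equality almost everywhere.\<close>
lemma AE_pullback:
  assumes ae: "AE y in \<nu>. R y"
  shows "AE x in \<nu>. AE u in P. R (A u x)"
proof -
  from ae obtain N where N: "{y \<in> space \<nu>. \<not> R y} \<subseteq> N" "N \<in> null_sets \<nu>"
    by (auto elim: AE_E simp: null_sets_def)
  have [measurable]: "N \<in> sets borel" using null_setsD2[OF N(2)] by (simp add: sets_haar)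
  have "(indicator N :: 'g \<Rightarrow> complex) \<in> borel_measurable borel" by simp
  then obtain F :: "'a \<times> 'g \<Rightarrow> complex" where [measurable]: "F \<in> borel_measurable (P \<Otimes>\<^sub>M \<nu>)"
    and F: "AE u in P. AE x in \<nu>. F (u, x) = indicator N (A u x)"
      "AE x in \<nu>. AE u in P. F (u, x) = indicator N (A u x)"
    by (rule borel_pullback)
  have "AE u in P. AE x in \<nu>. F (u, x) = 0"
    using F(1) AE_Aut
  proof eventually_elim
    case (elim u)
    from elim(1) AE_vimage_Aut[OF elim(2) AE_not_in[OF N(2)]]
    show ?case by eventually_elim simp
  qed
  then have "AE x in \<nu>. AE u in P. F (u, x) = 0"
    by (subst AE_commute[symmetric]) simp_all
  with F(2) show ?thesis
  proof eventually_elim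
    case (elim x)
    from elim show ?case
      by eventually_elim (use N(1) in \<open>auto simp: indicator_def split: if_splits\<close>)
  qed
qed

end

section \<open>Essentially bounded functions and characters under automorphisms\<close>

lemma (in compact_haar) Linfty_iff:
  "f \<in> Linfty \<nu> \<longleftrightarrow> f \<in> borel_measurable borel \<and> (\<exists>c::real. AE x in \<nu>. cmod (f x) \<le> c)"
proof (intro iffI conjI)
  assume f: "f \<in> Linfty \<nu>"
  then show fm: "f \<in> borel_measurable borel" unfolding Linfty_def by simp
  have "esssup \<nu> (\<lambda>x. ereal (cmod (f x))) < \<infinity>" using f unfolding Linfty_def by simp
  then have "esssup \<nu> (\<lambda>x. ereal (cmod (f x))) \<le> ereal (real_of_ereal (esssup \<nu> (\<lambda>x. ereal (cmod (f x)))))"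
    by (cases "esssup \<nu> (\<lambda>x. ereal (cmod (f x)))") auto
  then show "\<exists>c::real. AE x in \<nu>. cmod (f x) \<le> c"
    using esssup_AE[of "\<lambda>x. ereal (cmod (f x))" \<nu>]
    by (intro exI[of _ "real_of_ereal (esssup \<nu> (\<lambda>x. ereal (cmod (f x))))"])
      (auto elim!: eventually_mono dest: order_trans)
next
  assume f: "f \<in> borel_measurable borel \<and> (\<exists>c::real. AE x in \<nu>. cmod (f x) \<le> c)"
  then have [measurable]: "f \<in> borel_measurable borel" by simp
  from f obtain c :: real where "AE x in \<nu>. ereal (cmod (f x)) \<le> ereal c" by auto
  then have "esssup \<nu> (\<lambda>x. ereal (cmod (f x))) \<le> ereal c" by (intro esssup_I) simp_all
  then show "f \<in> Linfty \<nu>" unfolding Linfty_def by (auto dest: order_le_less_trans)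
qed

lemma (in compact_haar) esssup_cmod_nonneg: "0 \<le> esssup \<nu> (\<lambda>x. ereal (cmod (f x)))"
proof (cases "(\<lambda>x. ereal (cmod (f x))) \<in> borel_measurable \<nu>")
  case True
  have "esssup \<nu> (\<lambda>x. 0 :: ereal) \<le> esssup \<nu> (\<lambda>x. ereal (cmod (f x)))"
    by (intro esssup_mono) simp_all
  then show ?thesis using esssup_const[of \<nu> "0::ereal"] by (simp add: emeasure_UNIV)
qed (simp add: esssup_non_measurable)

lemma (in compact_haar) Linfty_norm_nonneg: "0 \<le> Linfty_norm \<nu> f"
  unfolding Linfty_norm_def using esssup_cmod_nonneg by (rule real_of_ereal_pos)

lemma (in compact_haar) AE_le_Linfty_norm:
  assumes "f \<in> Linfty \<nu>"
  shows "AE x in \<nu>. cmod (f x) \<le> Linfty_norm \<nu> f"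
proof -
  let ?E = "esssup \<nu> (\<lambda>x. ereal (cmod (f x)))"
  have fin: "?E < \<infinity>" using assms unfolding Linfty_def by simp
  have "AE x in \<nu>. ereal (cmod (f x)) \<le> ?E" by (rule esssup_AE)
  then show ?thesis
  proof eventually_elim
    case (elim x)
    then show ?case unfolding Linfty_norm_def using fin by (cases ?E) auto
  qed
qed

lemma (in compact_haar) Linfty_norm_le:
  assumes "f \<in> borel_measurable borel" "AE x in \<nu>. cmod (f x) \<le> c"
  shows "Linfty_norm \<nu> f \<le> c"
proof -
  note [measurable] = assms(1)
  have "esssup \<nu> (\<lambda>x. ereal (cmod (f x))) \<le> ereal c"
    using assms(2) by (intro esssup_I) simp_all
  with esssup_cmod_nonneg[of f] show ?thesis unfolding Linfty_norm_def
    by (cases "esssup \<nu> (\<lambda>x. ereal (cmod (f x)))") auto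
qed

lemma (in compact_haar) Linfty_subset_L2: "Linfty \<nu> \<subseteq> L2 \<nu>"
proof
  fix f assume f: "f \<in> Linfty \<nu>"
  then have [measurable]: "f \<in> borel_measurable borel" unfolding Linfty_iff by simp
  have "integrable \<nu> (\<lambda>x. (cmod (f x))\<^sup>2)"
  proof (rule integrable_const_bound)
    show "AE x in \<nu>. norm ((cmod (f x))\<^sup>2) \<le> (Linfty_norm \<nu> f)\<^sup>2"
      using AE_le_Linfty_norm[OF f] by eventually_elim (simp add: power_mono)
  qed simp
  then show "f \<in> L2 \<nu>" unfolding L2_def by simp
qed

lemma (in compact_haar) fourier_vimage_Aut:
  assumes B: "B \<in> Aut" and [measurable]: "f \<in> borel_measurable borel" and \<eta>: "continuous_on UNIV \<eta>"
  shows "(LINT x|\<nu>. f (B x) * cnj (\<eta> x)) = fourier \<nu> f (\<eta> \<circ> inv_into UNIV B)"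
proof -
  have "continuous_on UNIV (\<lambda>y. cnj (\<eta> (inv_into UNIV B y)))"
    by (intro continuous_intros continuous_on_compose2[OF \<eta> AutD(3)[OF AutD(4)[OF B]]]) simp
  note [measurable] = borel_measurable_continuous_onI[OF this] Aut_borel[OF B]
  have "fourier \<nu> f (\<eta> \<circ> inv_into UNIV B) = (LINT y|distr \<nu> borel B. f y * cnj (\<eta> (inv_into UNIV B y)))"
    unfolding fourier_def distr_Aut[OF B] by simp
  also have "\<dots> = (LINT x|\<nu>. f (B x) * cnj (\<eta> (inv_into UNIV B (B x))))"
    by (rule integral_distr) simp_all
  finally show ?thesis by (simp add: AutD(5)[OF B])
qed

text \<open>An automorphism of the character group that maps positive characters to positive ones also maps negative
  characters to negative ones, as the order is total and inversion (complex conjugation)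
  exchanges the two kinds. So its inverse preserves signs too.\<close>
lemma sgn_pos_inv_aut_plus:
  fixes r :: "('g::topological_ab_group_add \<Rightarrow> complex) rel"
  assumes order: "compatible_total_order r" and B: "B \<in> aut_plus r" and \<eta>: "\<eta> \<in> carrier char_group"
  shows "\<eta> \<circ> inv_into UNIV B \<in> carrier char_group" "sgn_pos r (\<eta> \<circ> inv_into UNIV B) = sgn_pos r \<eta>"
proof -
  let ?I = "inv_into UNIV B"
  define \<psi> where "\<psi> = \<eta> \<circ> ?I"
  have B': "bij B" "\<And>x y. B (x + y) = B x + B y" "continuous_on UNIV ?I"
    and pos: "dual_aut B ` pos_chars r \<subseteq> pos_chars r"
    using B unfolding aut_plus_def Aut_def aut_plus_dual_def by auto
  have i: "?I (B x) = x" "B (?I x) = x" for x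
    using B'(1) by (simp_all add: bij_is_inj bij_is_surj surj_f_inv_f)
  have "?I (x + y) = ?I x + ?I y" for x y
    using B'(2)[of "?I x" "?I y"] i by metis
  moreover have "continuous_on UNIV \<psi>"
    unfolding \<psi>_def using \<eta> B'(3) unfolding char_group_def characters_def
    by (auto simp: o_def intro: continuous_on_compose2)
  ultimately have \<psi>: "\<psi> \<in> carrier char_group"
    using \<eta> unfolding \<psi>_def char_group_def characters_def by auto
  then show "\<eta> \<circ> ?I \<in> carrier char_group" unfolding \<psi>_def .
  have \<eta>\<psi>: "\<psi> \<circ> B = \<eta>" unfolding \<psi>_def by (auto simp: i)
  have lin: "linear_order_on (carrier char_group) r"
    and comp: "\<And>a b c. a \<in> carrier char_group \<Longrightarrow> b \<in> carrier char_group \<Longrightarrow> c \<in> carrier char_group \<Longrightarrow>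
      (a, b) \<in> r \<Longrightarrow> (\<lambda>x. a x * c x, \<lambda>x. b x * c x) \<in> r"
    using order unfolding compatible_total_order_def char_group_def by auto
  have one: "(\<lambda>x. 1) \<in> carrier char_group"
    unfolding char_group_def characters_def by auto
  have unit: "z * cnj z = 1" "cnj z * z = 1" if "cmod z = 1" for z
    using complex_norm_square[of z] that by (simp_all add: mult.commute)
  have cnj: "(\<lambda>x. cnj (a x)) \<in> carrier char_group" "(\<lambda>x. a x * cnj (a x)) = (\<lambda>x. 1)" "(\<lambda>x. cnj (a x) * a x) = (\<lambda>x. 1)"
    if "a \<in> carrier char_group" for a
    using that unfolding char_group_def characters_def
    by (auto intro!: continuous_intros simp: unit)
  have pos_iff: "a \<in> pos_chars r \<longleftrightarrow> a \<in> carrier char_group \<and> (\<lambda>x. 1, a) \<in> r" for a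
    unfolding pos_chars_def char_group_def by simp
  have total: "(a, b) \<in> r \<or> (b, a) \<in> r" if "a \<in> carrier char_group" "b \<in> carrier char_group" for a b
  proof -
    have "refl_on (carrier char_group) r" "total_on (carrier char_group) r"
      using lin unfolding linear_order_on_def partial_order_on_def preorder_on_def by simp_all
    with that show ?thesis by (cases "a = b") (auto simp: total_on_def dest: refl_onD)
  qed
  have neg: "(\<lambda>x. cnj (a x)) \<in> pos_chars r" if "a \<in> carrier char_group" "a \<notin> pos_chars r" for a
  proof -
    have "(\<lambda>x. 1, a) \<notin> r" using that by (simp add: pos_iff)
    with total[OF that(1) one] have "(a, \<lambda>x. 1) \<in> r" by simp
    from comp[OF that(1) one cnj(1)[OF that(1)] this] have "(\<lambda>x. 1, \<lambda>x. cnj (a x)) \<in> r"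
      unfolding cnj(2)[OF that(1)] mult_1 .
    with cnj(1)[OF that(1)] show ?thesis unfolding pos_iff by (rule conjI)
  qed
  have below_unit: "(a, \<lambda>x. 1) \<in> r" if "a \<in> carrier char_group" "(\<lambda>x. cnj (a x)) \<in> pos_chars r" for a
  proof -
    have "(\<lambda>x. 1, \<lambda>x. cnj (a x)) \<in> r" using that(2) unfolding pos_iff by (rule conjunct2)
    from comp[OF one cnj(1)[OF that(1)] that(1) this] show ?thesis
      unfolding cnj(3)[OF that(1)] mult_1 .
  qed
  have anti: "a = b" if "(a, b) \<in> r" "(b, a) \<in> r" for a b
  proof -
    have "antisym r" using lin unfolding linear_order_on_def partial_order_on_def by simp
    then show ?thesis using that by (rule antisymD)
  qed
  have one_iff: "\<psi> = (\<lambda>x. 1) \<longleftrightarrow> \<eta> = (\<lambda>x. 1)"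
  proof
    assume "\<psi> = (\<lambda>x. 1)"
    then have "\<psi> \<circ> B = (\<lambda>x. 1)" by (simp only: o_def)
    then show "\<eta> = (\<lambda>x. 1)" by (simp only: \<eta>\<psi>)
  next
    assume "\<eta> = (\<lambda>x. 1)"
    then show "\<psi> = (\<lambda>x. 1)" by (simp only: \<psi>_def o_def)
  qed
  have "\<psi> \<in> pos_chars r \<longleftrightarrow> \<eta> \<in> pos_chars r" if "\<eta> \<noteq> (\<lambda>x. 1)"
  proof
    assume "\<psi> \<in> pos_chars r"
    then have "dual_aut B \<psi> \<in> pos_chars r" by (rule subsetD[OF pos imageI])
    then show "\<eta> \<in> pos_chars r" unfolding dual_aut_def \<eta>\<psi> .
  next
    assume p: "\<eta> \<in> pos_chars r"
    show "\<psi> \<in> pos_chars r"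
    proof (rule ccontr)
      assume "\<psi> \<notin> pos_chars r"
      then have "dual_aut B (\<lambda>x. cnj (\<psi> x)) \<in> pos_chars r"
        by (rule subsetD[OF pos imageI[OF neg[OF \<psi>]]])
      moreover have "dual_aut B (\<lambda>x. cnj (\<psi> x)) = (\<lambda>x. cnj (\<eta> x))"
      proof -
        have "dual_aut B (\<lambda>x. cnj (\<psi> x)) = (\<lambda>x. cnj ((\<psi> \<circ> B) x))"
          unfolding dual_aut_def comp_def by (rule refl)
        then show ?thesis unfolding \<eta>\<psi> .
      qed
      ultimately have "(\<lambda>x. cnj (\<eta> x)) \<in> pos_chars r" by (simp only:)
      then have "(\<eta>, \<lambda>x. 1) \<in> r" by (rule below_unit[OF \<eta>])
      moreover have "(\<lambda>x. 1, \<eta>) \<in> r" using p unfolding pos_iff by (rule conjunct2)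
      ultimately have "\<eta> = (\<lambda>x. 1)" by (rule anti)
      with that show False by (rule notE)
    qed
  qed
  note pos_eq = this
  have unit_eq: "\<one>\<^bsub>char_group\<^esub> = (\<lambda>x :: 'g. 1 :: complex)" by (simp add: char_group_def)
  have "sgn_pos r \<psi> = sgn_pos r \<eta>"
  proof (cases "\<eta> = (\<lambda>x. 1)")
    case True
    then show ?thesis unfolding sgn_pos_def unit_eq one_iff by (simp only: simp_thms if_True)
  next
    case False
    then show ?thesis unfolding sgn_pos_def unit_eq one_iff pos_eq[OF False] by (simp only: simp_thms if_False)
  qed
  then show "sgn_pos r (\<eta> \<circ> ?I) = sgn_pos r \<eta>" unfolding \<psi>_def .
qed

section \<open>Averages over a finite family of automorphisms\<close>

text \<open>For a Hausdorff operator with kernel \<open>\<Phi>\<close> the measure \<open>P\<close> is \<open>\<bar>\<Phi>\<bar> \<mu>\<close> and \<open>s\<close> is the phase of \<open>\<Phi>\<close>.\<close>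
locale aut_average = aut_family \<nu> P A
  for \<nu> :: "'g::{topological_ab_group_add, t2_space} measure" and P :: "'a measure" and A +
  fixes s :: "'a \<Rightarrow> complex"
  assumes s_measurable [measurable]: "s \<in> borel_measurable P" and s_le: "cmod (s u) \<le> 1"
begin

definition avg :: "('g \<Rightarrow> complex) \<Rightarrow> 'g \<Rightarrow> complex" where
  "avg f x = (LINT u|P. s u * f (A u x))"

lemma avg_AE_cong:
  assumes [measurable]: "f \<in> borel_measurable borel" "g \<in> borel_measurable borel"
    and ae: "AE x in \<nu>. f x = g x"
  shows "AE x in \<nu>. avg f x = avg g x"
  using AE_pullback[OF ae]
proof eventually_elim
  case (elim x)
  show ?case unfolding avg_def
    by (rule integral_cong_AE) (use elim in auto)
qed

lemma borel_pullback_avg: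
  assumes [measurable]: "f \<in> borel_measurable borel"
  obtains F where "F \<in> borel_measurable (P \<Otimes>\<^sub>M \<nu>)"
    "AE u in P. AE x in \<nu>. F (u, x) = f (A u x)" "AE x in \<nu>. AE u in P. F (u, x) = f (A u x)"
    "AE x in \<nu>. avg f x = (LINT u|P. s u * F (u, x))"
proof -
  obtain F where F [measurable]: "F \<in> borel_measurable (P \<Otimes>\<^sub>M \<nu>)"
    and ae: "AE u in P. AE x in \<nu>. F (u, x) = f (A u x)" "AE x in \<nu>. AE u in P. F (u, x) = f (A u x)"
    by (rule borel_pullback[OF assms])
  have "AE x in \<nu>. avg f x = (LINT u|P. s u * F (u, x))"
    using ae(2)
  proof eventually_elim
    case (elim x)
    have [measurable]: "(\<lambda>u. F (u, x)) \<in> borel_measurable P"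
      by (rule measurable_Pair1[OF F]) simp
    show ?case unfolding avg_def
      by (rule integral_cong_AE) (use elim in auto)
  qed
  with F ae show ?thesis by (rule that)
qed

text \<open>The integrand is jointly measurable only up to null sets, so the average is identified with a
  Borel function only up to equality almost everywhere.\<close>
lemma avg_version:
  assumes "f \<in> borel_measurable borel"
  obtains g where "g \<in> borel_measurable borel" "AE x in \<nu>. avg f x = g x"
proof -
  obtain F where [measurable]: "F \<in> borel_measurable (P \<Otimes>\<^sub>M \<nu>)"
    and F: "AE x in \<nu>. avg f x = (LINT u|P. s u * F (u, x))"
    by (rule borel_pullback_avg[OF assms])
  have "(\<lambda>x. LINT u|P. s u * F (u, x)) \<in> borel_measurable \<nu>"
    by measurable
  then show ?thesis using F by (intro that[of "\<lambda>x. LINT u|P. s u * F (u, x)"]) simp_all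
qed

lemma Linfty_avg:
  assumes f: "f \<in> Linfty \<nu>" and g: "g \<in> borel_measurable borel" "AE x in \<nu>. avg f x = g x"
  shows "g \<in> Linfty \<nu>" "Linfty_norm \<nu> g \<le> measure P (space P) * Linfty_norm \<nu> f"
proof -
  have [measurable]: "f \<in> borel_measurable borel" using f unfolding Linfty_iff by simp
  let ?c = "Linfty_norm \<nu> f"
  have ae: "AE x in \<nu>. cmod (g x) \<le> measure P (space P) * ?c"
    using g(2) AE_pullback[OF AE_le_Linfty_norm[OF f]]
  proof eventually_elim
    case (elim x)
    have b: "AE u in P. norm (s u * f (A u x)) \<le> ?c"
      using elim(2)
    proof eventually_elim
      case (elim u)
      show ?case using mult_mono[OF s_le[of u] elim] by (simp add: norm_mult)
    qed
    have int: "integrable P (\<lambda>u. s u * f (A u x))"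
      by (rule P.integrable_const_bound[OF b]) simp
    have "cmod (g x) \<le> (LINT u|P. norm (s u * f (A u x)))"
      unfolding elim(1)[symmetric] avg_def by (rule integral_norm_bound)
    also have "\<dots> \<le> (LINT u|P. ?c)"
      by (rule integral_mono_AE) (use int b in auto)
    finally show ?case by simp
  qed
  show "g \<in> Linfty \<nu>" unfolding Linfty_iff using g(1) ae by blast
  show "Linfty_norm \<nu> g \<le> measure P (space P) * ?c" by (rule Linfty_norm_le[OF g(1) ae])
qed

lemma L2_pullback:
  assumes f: "f \<in> L2 \<nu>" and F [measurable]: "F \<in> borel_measurable (P \<Otimes>\<^sub>M \<nu>)"
    and ae: "AE u in P. AE x in \<nu>. F (u, x) = f (A u x)"
  shows "(\<integral>\<^sup>+ p. (ennreal (cmod (F p)))\<^sup>2 \<partial>(P \<Otimes>\<^sub>M \<nu>)) < \<infinity>" "integrable (P \<Otimes>\<^sub>M \<nu>) F"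
proof -
  have [measurable]: "f \<in> borel_measurable borel" and f2: "integrable \<nu> (\<lambda>x. (cmod (f x))\<^sup>2)"
    using f unfolding L2_def by simp_all
  have "(\<integral>\<^sup>+ p. (ennreal (cmod (F p)))\<^sup>2 \<partial>(P \<Otimes>\<^sub>M \<nu>)) = (\<integral>\<^sup>+ u. \<integral>\<^sup>+ x. (ennreal (cmod (F (u, x))))\<^sup>2 \<partial>\<nu> \<partial>P)"
    by (rule sigma_finite_measure.nn_integral_fst[OF prob_space_imp_sigma_finite[OF prob_space_axioms], symmetric]) simp
  also have "\<dots> = (\<integral>\<^sup>+ u. \<integral>\<^sup>+ x. (ennreal (cmod (f x)))\<^sup>2 \<partial>\<nu> \<partial>P)"
  proof (rule nn_integral_cong_AE)
    show "AE u in P. (\<integral>\<^sup>+ x. (ennreal (cmod (F (u, x))))\<^sup>2 \<partial>\<nu>) = (\<integral>\<^sup>+ x. (ennreal (cmod (f x)))\<^sup>2 \<partial>\<nu>)"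
      using ae AE_Aut
    proof eventually_elim
      case (elim u)
      have "(\<integral>\<^sup>+ x. (ennreal (cmod (F (u, x))))\<^sup>2 \<partial>\<nu>) = (\<integral>\<^sup>+ x. (ennreal (cmod (f (A u x))))\<^sup>2 \<partial>\<nu>)"
        by (rule nn_integral_cong_AE) (use elim(1) in auto)
      also have "\<dots> = (\<integral>\<^sup>+ x. (ennreal (cmod (f x)))\<^sup>2 \<partial>distr \<nu> borel (A u))"
        using Aut_borel[OF elim(2)] by (subst nn_integral_distr) simp_all
      finally show ?case by (simp only: distr_Aut[OF elim(2)])
    qed
  qed
  also have "\<dots> < \<infinity>"
  proof -
    have "(\<integral>\<^sup>+ x. (ennreal (cmod (f x)))\<^sup>2 \<partial>\<nu>) < \<infinity>"
      using f2 unfolding integrable_iff_bounded by (simp add: ennreal_power)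
    then show ?thesis by (simp add: ennreal_mult_eq_top_iff ennreal_mult_less_top P.emeasure_finite less_top[symmetric])
  qed
  finally show fin: "(\<integral>\<^sup>+ p. (ennreal (cmod (F p)))\<^sup>2 \<partial>(P \<Otimes>\<^sub>M \<nu>)) < \<infinity>" .
  interpret PP: finite_measure "P \<Otimes>\<^sub>M \<nu>"
    by (rule finite_measure_pair_measure) unfold_locales
  have "integrable (P \<Otimes>\<^sub>M \<nu>) (\<lambda>p. (cmod (F p))\<^sup>2)"
    using fin unfolding integrable_iff_bounded by (simp add: ennreal_power)
  then have "integrable (P \<Otimes>\<^sub>M \<nu>) (\<lambda>p. cmod (F p))"
    by (rule PP.square_integrable_imp_integrable[rotated]) simp
  then show "integrable (P \<Otimes>\<^sub>M \<nu>) F" by (rule integrable_norm_cancel) simp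
qed

lemma AE_integrable_avg:
  assumes f: "f \<in> L2 \<nu>"
  shows "AE x in \<nu>. integrable P (\<lambda>u. s u * f (A u x))"
proof -
  have [measurable]: "f \<in> borel_measurable borel" using f unfolding L2_def by simp
  obtain F where F [measurable]: "F \<in> borel_measurable (P \<Otimes>\<^sub>M \<nu>)"
    and ae: "AE u in P. AE x in \<nu>. F (u, x) = f (A u x)" "AE x in \<nu>. AE u in P. F (u, x) = f (A u x)"
    by (rule borel_pullback[of f]) simp
  have "integrable (P \<Otimes>\<^sub>M \<nu>) (case_prod (\<lambda>u x. F (u, x)))"
    using L2_pullback(2)[OF f F ae(1)] by simp
  from AE_integrable_snd[OF this] ae(2) show ?thesis
  proof eventually_elim
    case (elim x)
    show ?case
    proof (rule Bochner_Integration.integrable_bound[OF elim(1)])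
      show "AE u in P. norm (s u * f (A u x)) \<le> norm (F (u, x))"
        using elim(2) by eventually_elim (simp add: norm_mult mult_left_le_one_le s_le)
    qed simp
  qed
qed

text \<open>By the Cauchy-Schwarz inequality in \<open>u\<close>, \<open>\<bar>avg f x\<bar>\<^sup>2\<close> is at most \<open>P(\<Omega>)\<close> times the integral of
  \<open>\<bar>f (A u x)\<bar>\<^sup>2\<close> over \<open>u\<close>. Tonelli and the invariance of Haar measure bound the integral over \<open>x\<close>.\<close>
lemma L2_avg:
  assumes f: "f \<in> L2 \<nu>" and g [measurable]: "g \<in> borel_measurable borel" and ga: "AE x in \<nu>. avg f x = g x"
  shows "g \<in> L2 \<nu>"
proof -
  have fm [measurable]: "f \<in> borel_measurable borel" using f unfolding L2_def by simp
  obtain F where F [measurable]: "F \<in> borel_measurable (P \<Otimes>\<^sub>M \<nu>)"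
    and ae: "AE u in P. AE x in \<nu>. F (u, x) = f (A u x)"
      "AE x in \<nu>. avg f x = (LINT u|P. s u * F (u, x))"
    by (rule borel_pullback_avg[OF fm])
  have "integrable (P \<Otimes>\<^sub>M \<nu>) (case_prod (\<lambda>u x. F (u, x)))"
    using L2_pullback(2)[OF f F ae(1)] by simp
  note int = AE_integrable_snd[OF this]
  have "(\<integral>\<^sup>+ x. (ennreal (cmod (g x)))\<^sup>2 \<partial>\<nu>) \<le> (\<integral>\<^sup>+ x. (\<integral>\<^sup>+ u. (ennreal (cmod (F (u, x))))\<^sup>2 \<partial>P) * emeasure P (space P) \<partial>\<nu>)"
  proof (rule nn_integral_mono_AE)
    show "AE x in \<nu>. (ennreal (cmod (g x)))\<^sup>2 \<le> (\<integral>\<^sup>+ u. (ennreal (cmod (F (u, x))))\<^sup>2 \<partial>P) * emeasure P (space P)"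
      using ga ae(2) int
    proof eventually_elim
      case (elim x)
      have [measurable]: "(\<lambda>u. F (u, x)) \<in> borel_measurable P"
        using elim(3) by (rule borel_measurable_integrable)
      have "ennreal (cmod (g x)) \<le> (\<integral>\<^sup>+ u. norm (s u * F (u, x)) \<partial>P)"
        unfolding elim(1)[symmetric] elim(2)
      proof (rule integral_norm_bound_ennreal)
        show "integrable P (\<lambda>u. s u * F (u, x))"
          by (rule Bochner_Integration.integrable_bound[OF elim(3)])
            (auto simp: norm_mult mult_left_le_one_le s_le)
      qed
      also have "\<dots> \<le> (\<integral>\<^sup>+ u. ennreal (cmod (F (u, x))) * 1 \<partial>P)"
        by (intro nn_integral_mono) (simp add: norm_mult mult_left_le_one_le s_le)
      finally have "(ennreal (cmod (g x)))\<^sup>2 \<le> (\<integral>\<^sup>+ u. ennreal (cmod (F (u, x))) * 1 \<partial>P)\<^sup>2"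
        by (rule power_mono) simp
      also have "\<dots> \<le> (\<integral>\<^sup>+ u. (ennreal (cmod (F (u, x))))\<^sup>2 \<partial>P) * (\<integral>\<^sup>+ u. 1\<^sup>2 \<partial>P)"
        by (rule Cauchy_Schwarz_nn_integral) simp_all
      finally show ?case by simp
    qed
  qed
  also have "\<dots> = (\<integral>\<^sup>+ x. (\<integral>\<^sup>+ u. (ennreal (cmod (F (u, x))))\<^sup>2 \<partial>P) \<partial>\<nu>) * emeasure P (space P)"
    by (rule nn_integral_multc) measurable
  also have "(\<integral>\<^sup>+ x. (\<integral>\<^sup>+ u. (ennreal (cmod (F (u, x))))\<^sup>2 \<partial>P) \<partial>\<nu>) = (\<integral>\<^sup>+ p. (ennreal (cmod (F p)))\<^sup>2 \<partial>(P \<Otimes>\<^sub>M \<nu>))"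
    by (rule nn_integral_snd) simp
  also have "\<dots> * emeasure P (space P) < \<infinity>"
    using L2_pullback(1)[OF f F ae(1)] by (simp add: ennreal_mult_eq_top_iff ennreal_mult_less_top P.emeasure_finite less_top[symmetric])
  finally have "integrable \<nu> (\<lambda>x. (cmod (g x))\<^sup>2)"
    unfolding integrable_iff_bounded by (simp add: ennreal_power)
  then show ?thesis unfolding L2_def by simp
qed

text \<open>The function \<open>c\<close> replaces \<open>u \<mapsto> s u * fourier \<nu> f (\<eta> \<circ> inv_into UNIV (A u))\<close>, for which Fubini gives
  measurability only after a change on a null set.\<close>
lemma fourier_avg:
  assumes f: "f \<in> L2 \<nu>" and g [measurable]: "g \<in> borel_measurable borel" and ga: "AE x in \<nu>. avg f x = g x"
    and \<eta>: "continuous_on UNIV \<eta>" "\<And>x. cmod (\<eta> x) = 1"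
  obtains c where "c \<in> borel_measurable P"
    "AE u in P. c u = s u * fourier \<nu> f (\<eta> \<circ> inv_into UNIV (A u))"
    "fourier \<nu> g \<eta> = (LINT u|P. c u)"
proof -
  have fm [measurable]: "f \<in> borel_measurable borel" using f unfolding L2_def by simp
  have [measurable]: "\<eta> \<in> borel_measurable borel" by (rule borel_measurable_continuous_onI[OF \<eta>(1)])
  have [measurable]: "cnj \<in> borel_measurable borel"
    by (intro borel_measurable_continuous_onI continuous_intros)
  obtain F where F [measurable]: "F \<in> borel_measurable (P \<Otimes>\<^sub>M \<nu>)"
    and ae: "AE u in P. AE x in \<nu>. F (u, x) = f (A u x)"
      "AE x in \<nu>. avg f x = (LINT u|P. s u * F (u, x))"
    by (rule borel_pullback_avg[OF fm])
  define c where "c u = (LINT x|\<nu>. s u * F (u, x) * cnj (\<eta> x))" for u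
  have c [measurable]: "c \<in> borel_measurable P"
    unfolding c_def by measurable
  have "integrable (P \<Otimes>\<^sub>M \<nu>) (\<lambda>p. s (fst p) * F p * cnj (\<eta> (snd p)))"
    by (rule Bochner_Integration.integrable_bound[OF L2_pullback(2)[OF f F ae(1)]])
      (auto simp: norm_mult \<eta>(2) mult_left_le_one_le s_le)
  then have int: "integrable (P \<Otimes>\<^sub>M \<nu>) (case_prod (\<lambda>u x. s u * F (u, x) * cnj (\<eta> x)))"
    by (simp add: case_prod_beta')
  have "fourier \<nu> g \<eta> = (LINT x|\<nu>. LINT u|P. s u * F (u, x) * cnj (\<eta> x))"
    unfolding fourier_def
  proof (rule integral_cong_AE)
    show "AE x in \<nu>. g x * cnj (\<eta> x) = (LINT u|P. s u * F (u, x) * cnj (\<eta> x))"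
      using ga ae(2) by eventually_elim simp
    show "(\<lambda>x. LINT u|P. s u * F (u, x) * cnj (\<eta> x)) \<in> borel_measurable \<nu>"
      by measurable
  qed simp
  also have "\<dots> = (LINT u|P. c u)"
    unfolding c_def by (rule Fubini_integral[OF int])
  finally have eq: "fourier \<nu> g \<eta> = (LINT u|P. c u)" .
  have "AE u in P. c u = s u * fourier \<nu> f (\<eta> \<circ> inv_into UNIV (A u))"
    using ae(1) AE_Aut AE_space
  proof eventually_elim
    case (elim u)
    note [measurable] = Aut_borel[OF elim(2)]
    have [measurable]: "(\<lambda>x. F (u, x)) \<in> borel_measurable borel"
      using measurable_Pair2[OF F elim(3)] by simp
    have "AE x in \<nu>. s u * F (u, x) * cnj (\<eta> x) = s u * (f (A u x) * cnj (\<eta> x))"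
      using elim(1) by eventually_elim simp
    then have "c u = (LINT x|\<nu>. s u * (f (A u x) * cnj (\<eta> x)))"
      unfolding c_def by (intro integral_cong_AE) simp_all
    then show ?case
      using fourier_vimage_Aut[OF elim(2) fm \<eta>(1)] by simp
  qed
  with c eq show ?thesis by (intro that[of c])
qed

text \<open>The multiplier of the Hilbert transform takes the same value at \<open>\<eta>\<close> and at \<open>\<eta> \<circ> inv_into UNIV (A u)\<close>,
  so it can be taken out of the integral over \<open>u\<close>.\<close>
lemma is_hilbert_transform_avg:
  assumes order: "compatible_total_order r" and plus: "AE u in P. A u \<in> aut_plus r"
    and gh: "is_hilbert_transform \<nu> r g h"
    and g': "g' \<in> borel_measurable borel" "AE x in \<nu>. avg g x = g' x"
    and h': "h' \<in> borel_measurable borel" "AE x in \<nu>. avg h x = h' x"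
  shows "is_hilbert_transform \<nu> r g' h'"
  unfolding is_hilbert_transform_def
proof (intro conjI ballI)
  have g: "g \<in> L2 \<nu>" and h: "h \<in> L2 \<nu>"
    and F: "\<And>\<eta>. \<eta> \<in> carrier char_group \<Longrightarrow> fourier \<nu> h \<eta> = - \<i> * sgn_pos r \<eta> * fourier \<nu> g \<eta>"
    using gh unfolding is_hilbert_transform_def by auto
  show "g' \<in> L2 \<nu>" by (rule L2_avg[OF g g'])
  show "h' \<in> L2 \<nu>" by (rule L2_avg[OF h h'])
  fix \<eta> :: "'g \<Rightarrow> complex" assume \<eta>: "\<eta> \<in> carrier char_group"
  then have "continuous_on UNIV \<eta>" "\<And>x. cmod (\<eta> x) = 1"
    unfolding char_group_def characters_def by auto
  note cont = this
  obtain c where c [measurable]: "c \<in> borel_measurable P"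
    and c_eq: "AE u in P. c u = s u * fourier \<nu> g (\<eta> \<circ> inv_into UNIV (A u))" "fourier \<nu> g' \<eta> = (LINT u|P. c u)"
    by (rule fourier_avg[OF g g' cont])
  obtain d where d [measurable]: "d \<in> borel_measurable P"
    and d_eq: "AE u in P. d u = s u * fourier \<nu> h (\<eta> \<circ> inv_into UNIV (A u))" "fourier \<nu> h' \<eta> = (LINT u|P. d u)"
    by (rule fourier_avg[OF h h' cont])
  have "fourier \<nu> h' \<eta> = (LINT u|P. - \<i> * sgn_pos r \<eta> * c u)"
    unfolding d_eq(2)
  proof (rule integral_cong_AE)
    show "AE u in P. d u = - \<i> * sgn_pos r \<eta> * c u"
      using c_eq(1) d_eq(1) plus
    proof eventually_elim
      case (elim u)
      note inv = sgn_pos_inv_aut_plus[OF order elim(3) \<eta>]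
      show ?case unfolding elim(1,2) F[OF inv(1)] inv(2) by (simp add: mult_ac)
    qed
  qed simp_all
  also have "\<dots> = - \<i> * sgn_pos r \<eta> * fourier \<nu> g' \<eta>"
    unfolding c_eq(2) by (rule integral_mult_right_zero)
  finally show "fourier \<nu> h' \<eta> = - \<i> * sgn_pos r \<eta> * fourier \<nu> g' \<eta>" .
qed

text \<open>Averaging \<open>f\<close>, \<open>g\<close> and the Hilbert transform of \<open>g\<close> separately gives a decomposition of the average.\<close>
lemma bmo_decomp_avg:
  assumes order: "compatible_total_order r" and plus: "AE u in P. A u \<in> aut_plus r"
    and \<phi> [measurable]: "\<phi> \<in> borel_measurable borel" and fg: "bmo_decomp \<nu> r \<phi> f g"
  obtains \<psi> f' g' where "\<psi> \<in> borel_measurable borel" "AE x in \<nu>. avg \<phi> x = \<psi> x"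
    "bmo_decomp \<nu> r (avg \<phi>) f' g'" "bmo_decomp \<nu> r \<psi> f' g'"
    "AE x in \<nu>. integrable P (\<lambda>u. s u * \<phi> (A u x))"
    "Linfty_norm \<nu> f' + Linfty_norm \<nu> g' \<le> measure P (space P) * (Linfty_norm \<nu> f + Linfty_norm \<nu> g)"
proof -
  note fg' = fg[unfolded bmo_decomp_def]
  have f: "f \<in> Linfty \<nu>" by (rule fg'[THEN conjunct1])
  have g: "g \<in> Linfty \<nu>" by (rule fg'[THEN conjunct2, THEN conjunct1])
  obtain h where "is_hilbert_transform \<nu> r g h \<and> (AE x in \<nu>. \<phi> x = f x + h x)"
    by (rule exE[OF fg'[THEN conjunct2, THEN conjunct2]])
  then have h: "is_hilbert_transform \<nu> r g h" and eq: "AE x in \<nu>. \<phi> x = f x + h x" by simp_all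
  have f2: "f \<in> L2 \<nu>" and h2: "h \<in> L2 \<nu>"
    using f Linfty_subset_L2 h unfolding is_hilbert_transform_def by auto
  have [measurable]: "f \<in> borel_measurable borel" "g \<in> borel_measurable borel" "h \<in> borel_measurable borel"
    using f g h2 unfolding Linfty_iff L2_def by simp_all
  obtain f' where f' [measurable]: "f' \<in> borel_measurable borel" "AE x in \<nu>. avg f x = f' x"
    by (rule avg_version[of f]) simp
  obtain g' where g' [measurable]: "g' \<in> borel_measurable borel" "AE x in \<nu>. avg g x = g' x"
    by (rule avg_version[of g]) simp
  obtain h' where h' [measurable]: "h' \<in> borel_measurable borel" "AE x in \<nu>. avg h x = h' x"
    by (rule avg_version[of h]) simp
  have H: "is_hilbert_transform \<nu> r g' h'"
    by (rule is_hilbert_transform_avg[OF order plus h g' h'])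
  have both: "AE x in \<nu>. integrable P (\<lambda>u. s u * \<phi> (A u x)) \<and> avg \<phi> x = f' x + h' x"
    using AE_pullback[OF eq] AE_integrable_avg[OF f2] AE_integrable_avg[OF h2] f'(2) h'(2)
  proof eventually_elim
    case (elim x)
    have ae: "AE u in P. s u * f (A u x) + s u * h (A u x) = s u * \<phi> (A u x)"
      using elim(1) by eventually_elim (simp add: algebra_simps)
    have int: "integrable P (\<lambda>u. s u * f (A u x) + s u * h (A u x))"
      by (rule Bochner_Integration.integrable_add[OF elim(2,3)])
    have "integrable P (\<lambda>u. s u * \<phi> (A u x))"
      by (rule integrable_cong_AE_imp[OF int]) (use ae in auto)
    moreover have "avg \<phi> x = (LINT u|P. s u * f (A u x) + s u * h (A u x))"
      unfolding avg_def by (rule integral_cong_AE) (use ae in auto)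
    moreover have "\<dots> = avg f x + avg h x"
      unfolding avg_def by (rule Bochner_Integration.integral_add[OF elim(2,3)])
    ultimately show ?case using elim(4,5) by simp
  qed
  show ?thesis
  proof (rule that[of "\<lambda>x. f' x + h' x" f' g'])
    have L: "f' \<in> Linfty \<nu>" "g' \<in> Linfty \<nu>"
      using Linfty_avg(1)[OF f f'] Linfty_avg(1)[OF g g'] by auto
    show "AE x in \<nu>. avg \<phi> x = f' x + h' x" "AE x in \<nu>. integrable P (\<lambda>u. s u * \<phi> (A u x))"
      using both by (auto elim: eventually_mono)
    then show "bmo_decomp \<nu> r (avg \<phi>) f' g'" "bmo_decomp \<nu> r (\<lambda>x. f' x + h' x) f' g'"
      unfolding bmo_decomp_def using L H by auto
    show "Linfty_norm \<nu> f' + Linfty_norm \<nu> g' \<le> measure P (space P) * (Linfty_norm \<nu> f + Linfty_norm \<nu> g)"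
      using Linfty_avg(2)[OF f f'] Linfty_avg(2)[OF g g'] by (simp add: distrib_left)
  qed simp
qed

end

section \<open>The Hausdorff operator on BMO\<close>

context compact_haar
begin

lemma BMO_norm_le_decomp:
  assumes "bmo_decomp \<nu> r \<phi> f g"
  shows "BMO_norm \<nu> r \<phi> \<le> Linfty_norm \<nu> f + Linfty_norm \<nu> g"
  unfolding BMO_norm_def
proof (rule cInf_lower)
  show "bdd_below {Linfty_norm \<nu> f + Linfty_norm \<nu> g |f g. bmo_decomp \<nu> r \<phi> f g}"
    by (rule bdd_belowI[of _ 0]) (auto simp: Linfty_norm_nonneg)
qed (use assms in blast)

lemma const_in_BMO: "(\<lambda>x. c) \<in> BMO \<nu> r" "BMO_norm \<nu> r (\<lambda>x. c) \<le> cmod c"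
proof -
  have "(\<lambda>x. c) \<in> Linfty \<nu>" "(\<lambda>x. 0) \<in> Linfty \<nu>" unfolding Linfty_iff by auto
  moreover have "is_hilbert_transform \<nu> r (\<lambda>x. 0) (\<lambda>x. 0)"
    unfolding is_hilbert_transform_def L2_def fourier_def by simp
  ultimately have d: "bmo_decomp \<nu> r (\<lambda>x. c) (\<lambda>x. c) (\<lambda>x. 0)"
    unfolding bmo_decomp_def by (intro conjI exI[of _ "\<lambda>x. 0"]) auto
  then show "(\<lambda>x. c) \<in> BMO \<nu> r" unfolding BMO_def by auto
  have "Linfty_norm \<nu> (\<lambda>x. c) \<le> cmod c" "Linfty_norm \<nu> (\<lambda>x. 0) \<le> 0"
    by (rule Linfty_norm_le; simp)+
  then show "BMO_norm \<nu> r (\<lambda>x. c) \<le> cmod c" using BMO_norm_le_decomp[OF d] by simp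
qed

end

context aut_average
begin

text \<open>The estimate is proved for each decomposition of \<open>\<phi>\<close> and then passes to the infimum.\<close>
lemma BMO_avg:
  assumes order: "compatible_total_order r" and plus: "AE u in P. A u \<in> aut_plus r"
    and \<phi>: "\<phi> \<in> BMO \<nu> r"
  shows "AE x in \<nu>. integrable P (\<lambda>u. s u * \<phi> (A u x))"
    and "\<exists>\<psi>\<in>BMO \<nu> r. AE x in \<nu>. avg \<phi> x = \<psi> x"
    and "BMO_norm \<nu> r (avg \<phi>) \<le> measure P (space P) * BMO_norm \<nu> r \<phi>"
proof -
  let ?m = "measure P (space P)"
  have \<phi>m: "\<phi> \<in> borel_measurable borel" and ex: "\<exists>f g. bmo_decomp \<nu> r \<phi> f g"
    using \<phi> unfolding BMO_def by simp_all
  from ex obtain f g where "bmo_decomp \<nu> r \<phi> f g" by (elim exE)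
  then obtain \<psi> f' g' where \<psi>: "\<psi> \<in> borel_measurable borel" "AE x in \<nu>. avg \<phi> x = \<psi> x"
      "bmo_decomp \<nu> r \<psi> f' g'" and int: "AE x in \<nu>. integrable P (\<lambda>u. s u * \<phi> (A u x))"
    by (rule bmo_decomp_avg[OF order plus \<phi>m])
  show "AE x in \<nu>. integrable P (\<lambda>u. s u * \<phi> (A u x))" by (rule int)
  have "\<psi> \<in> BMO \<nu> r" unfolding BMO_def using \<psi>(1,3) by auto
  with \<psi>(2) show "\<exists>\<psi>\<in>BMO \<nu> r. AE x in \<nu>. avg \<phi> x = \<psi> x" by (rule bexI)
  have le: "BMO_norm \<nu> r (avg \<phi>) \<le> ?m * t"
    if "t \<in> {Linfty_norm \<nu> f + Linfty_norm \<nu> g |f g. bmo_decomp \<nu> r \<phi> f g}" for t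
  proof -
    from that obtain f g where t: "t = Linfty_norm \<nu> f + Linfty_norm \<nu> g" and d: "bmo_decomp \<nu> r \<phi> f g"
      by blast
    obtain f' g' where
      "bmo_decomp \<nu> r (avg \<phi>) f' g'" "Linfty_norm \<nu> f' + Linfty_norm \<nu> g' \<le> ?m * t"
      unfolding t by (rule bmo_decomp_avg[OF order plus \<phi>m d])
    then show ?thesis using BMO_norm_le_decomp order_trans by blast
  qed
  show "BMO_norm \<nu> r (avg \<phi>) \<le> ?m * BMO_norm \<nu> r \<phi>"
  proof (cases "?m = 0")
    case True
    with le ex show ?thesis by auto
  next
    case False
    then have "?m > 0" by (simp add: less_le)
    have "BMO_norm \<nu> r (avg \<phi>) / ?m \<le> BMO_norm \<nu> r \<phi>"
      unfolding BMO_norm_def[of \<nu> r \<phi>]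
    proof (rule cInf_greatest)
      show "{Linfty_norm \<nu> f + Linfty_norm \<nu> g |f g. bmo_decomp \<nu> r \<phi> f g} \<noteq> {}" using ex by auto
      fix t assume "t \<in> {Linfty_norm \<nu> f + Linfty_norm \<nu> g |f g. bmo_decomp \<nu> r \<phi> f g}"
      from le[OF this] show "BMO_norm \<nu> r (avg \<phi>) / ?m \<le> t"
        using \<open>?m > 0\<close> by (simp add: pos_divide_le_eq mult.commute)
    qed
    then show ?thesis using \<open>?m > 0\<close> by (simp add: pos_divide_le_eq mult.commute)
  qed
qed

end

text \<open>The separability of \<open>u \<mapsto> f \<circ> A u\<close> is given on sets of finite measure. The set where \<open>\<Phi>\<close> does not
  vanish is the union of the sets \<open>{1 / (n + 1) \<le> \<bar>\<Phi>\<bar>}\<close>, which have finite measure because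
  \<open>\<Phi>\<close> is integrable.\<close>
lemma aut_average_density:
  fixes \<nu> :: "'g::{topological_ab_group_add, t2_space} measure"
  assumes comp: "compact (UNIV :: 'g set)" and haar: "normalized_haar \<nu>"
    and A: "strongly_measurable_aut M A" and \<Phi>: "integrable M \<Phi>"
  shows "aut_average \<nu> (density M (\<lambda>u. cmod (\<Phi> u))) A (\<lambda>u. sgn (\<Phi> u))"
proof -
  have [measurable]: "\<Phi> \<in> borel_measurable M" using \<Phi> by (rule borel_measurable_integrable)
  let ?P = "density M (\<lambda>u. cmod (\<Phi> u))"
  have A_meas: "A \<in> measurable M aut_borel"
    and A_sep: "\<And>f S. continuous_on UNIV (f :: 'g \<Rightarrow> complex) \<Longrightarrow> S \<in> sets M \<Longrightarrow> emeasure M S < \<infinity> \<Longrightarrow>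
      \<exists>D. countable D \<and> (\<forall>d\<in>D. continuous_on UNIV d) \<and>
        (AE u in M. u \<in> S \<longrightarrow> (\<forall>\<epsilon>>0. \<exists>d\<in>D. \<forall>x. cmod (f (A u x) - d x) < \<epsilon>))"
    using A unfolding strongly_measurable_aut_def by simp_all
  show ?thesis
  proof (intro aut_average.intro aut_family.intro compact_haar.intro
      aut_family_axioms.intro aut_average_axioms.intro)
    show "compact (UNIV :: 'g set)" "normalized_haar \<nu>" by fact+
    show "finite_measure ?P"
    proof (rule finite_measureI)
      have "emeasure ?P (space ?P) = (\<integral>\<^sup>+ u. cmod (\<Phi> u) \<partial>M)"
        by (simp add: emeasure_density cong: nn_integral_cong)
      then show "emeasure ?P (space ?P) \<noteq> \<infinity>" using \<Phi> unfolding integrable_iff_bounded by simp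
    qed
    show "A \<in> measurable ?P aut_borel" using A_meas by simp
    show "(\<lambda>u. sgn (\<Phi> u)) \<in> borel_measurable ?P" by simp
    show "cmod (sgn (\<Phi> u)) \<le> 1" for u by (simp add: norm_sgn)
    fix f :: "'g \<Rightarrow> complex" assume f: "continuous_on UNIV f"
    define S where "S n = {u \<in> space M. cmod (\<Phi> u) \<ge> inverse (real (Suc n))}" for n
    have S: "S n \<in> sets M" for n unfolding S_def by measurable
    have "emeasure M (S n) < \<infinity>" for n
    proof -
      have "emeasure M (S n) \<le> ennreal (1 / inverse (real (Suc n)) * (LINT u|M. cmod (\<Phi> u)))"
        unfolding S_def using \<Phi> by (intro integral_Markov_inequality) simp_all
      then show ?thesis by (rule order_le_less_trans) simp
    qed
    with A_sep[OF f S] have "\<forall>n. \<exists>D. countable D \<and> (\<forall>d\<in>D. continuous_on UNIV d) \<and>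
        (AE u in M. u \<in> S n \<longrightarrow> (\<forall>\<epsilon>>0. \<exists>d\<in>D. \<forall>x. cmod (f (A u x) - d x) < \<epsilon>))"
      by simp
    then obtain D where "\<forall>n. countable (D n) \<and> (\<forall>d\<in>D n. continuous_on UNIV d) \<and>
        (AE u in M. u \<in> S n \<longrightarrow> (\<forall>\<epsilon>>0. \<exists>d\<in>D n. \<forall>x. cmod (f (A u x) - d x) < \<epsilon>))"
      by (rule choice[THEN exE])
    then have D: "\<And>n. countable (D n)" "\<And>n. \<forall>d\<in>D n. continuous_on UNIV d"
        "\<And>n. AE u in M. u \<in> S n \<longrightarrow> (\<forall>\<epsilon>>0. \<exists>d\<in>D n. \<forall>x. cmod (f (A u x) - d x) < \<epsilon>)"
      by simp_all
    have "AE u in M. \<forall>n. u \<in> S n \<longrightarrow> (\<forall>\<epsilon>>0. \<exists>d\<in>D n. \<forall>x. cmod (f (A u x) - d x) < \<epsilon>)"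
      using D(3) by (simp add: AE_all_countable)
    then have "AE u in M. 0 < ennreal (cmod (\<Phi> u)) \<longrightarrow>
        (\<forall>\<epsilon>>0. \<exists>d\<in>(\<Union>n. D n). \<forall>x. cmod (f (A u x) - d x) < \<epsilon>)"
      using AE_space
    proof eventually_elim
      case (elim u)
      show ?case
      proof (intro impI allI)
        fix \<epsilon> :: real assume "0 < ennreal (cmod (\<Phi> u))" "\<epsilon> > 0"
        then obtain n where "inverse (real (Suc n)) < cmod (\<Phi> u)"
          using reals_Archimedean[of "cmod (\<Phi> u)"] by auto
        then have "u \<in> S n" using elim(2) unfolding S_def by simp
        with elim(1) \<open>\<epsilon> > 0\<close> have "\<exists>d\<in>D n. \<forall>x. cmod (f (A u x) - d x) < \<epsilon>" by simp
        then show "\<exists>d\<in>(\<Union>n. D n). \<forall>x. cmod (f (A u x) - d x) < \<epsilon>" by (meson UNIV_I UN_I)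
      qed
    qed
    then have "AE u in ?P. \<forall>\<epsilon>>0. \<exists>d\<in>(\<Union>n. D n). \<forall>x. cmod (f (A u x) - d x) < \<epsilon>"
      by (subst AE_density) simp_all
    moreover have "countable (\<Union>n. D n)" using D(1) by simp
    moreover have "\<forall>d\<in>(\<Union>n. D n). continuous_on UNIV d" using D(2) by simp
    ultimately show "\<exists>D. countable D \<and> (\<forall>d\<in>D. continuous_on UNIV d) \<and>
        (AE u in ?P. \<forall>\<epsilon>>0. \<exists>d\<in>D. \<forall>x. cmod (f (A u x) - d x) < \<epsilon>)"
      by (intro exI[of _ "\<Union>n. D n"] conjI)
  qed
qed

theorem theorem4:
  fixes \<nu> :: "'g::{topological_ab_group_add, t2_space} measure"
    and r :: "('g \<Rightarrow> complex) rel"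
    and M :: "'a measure"
    and \<L> :: "'a set set"
    and A :: "'a \<Rightarrow> 'g \<Rightarrow> 'g"
    and \<Phi> :: "'a \<Rightarrow> complex"
  assumes "compact (UNIV :: 'g set)"
    and "connected (UNIV :: 'g set)"
    and "normalized_haar \<nu>"
    and "compatible_total_order r"
    and "strongly_measurable_aut M A"
    and "AE u in M. A u \<in> aut_plus r"
    and "locally_integrable M \<L> \<Phi>"
  shows "(hausdorff_bounded_on \<nu> M \<Phi> A (BMO \<nu> r) (BMO_norm \<nu> r) \<longleftrightarrow> integrable M \<Phi>) \<and>
         (integrable M \<Phi> \<longrightarrow>
            hausdorff_op_norm M \<Phi> A (BMO \<nu> r) (BMO_norm \<nu> r) \<le> (LINT u|M. cmod (\<Phi> u)))"
proof -
  interpret compact_haar \<nu> by (rule compact_haar.intro) fact+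
  have necessary: "integrable M \<Phi>" if "hausdorff_bounded_on \<nu> M \<Phi> A (BMO \<nu> r) (BMO_norm \<nu> r)"
  proof -
    have "\<forall>f\<in>BMO \<nu> r. AE x in \<nu>. integrable M (\<lambda>u. \<Phi> u * f (A u x))"
      using that unfolding hausdorff_bounded_on_def by (rule conjunct1)
    from bspec[OF this const_in_BMO(1)[of 1]] show ?thesis by simp
  qed
  have sufficient: "hausdorff_bounded_on \<nu> M \<Phi> A (BMO \<nu> r) (BMO_norm \<nu> r) \<and>
      hausdorff_op_norm M \<Phi> A (BMO \<nu> r) (BMO_norm \<nu> r) \<le> (LINT u|M. cmod (\<Phi> u))"
    if \<Phi>: "integrable M \<Phi>"
  proof -
    define P where "P = density M (\<lambda>u. cmod (\<Phi> u))"
    interpret aut_average \<nu> P A "\<lambda>u. sgn (\<Phi> u)"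
      unfolding P_def using assms(1,3,5) \<Phi> by (rule aut_average_density)
    have \<Phi>m [measurable]: "\<Phi> \<in> borel_measurable M" using \<Phi> by (rule borel_measurable_integrable)
    let ?m = "LINT u|M. cmod (\<Phi> u)"
    have m: "measure P (space P) = ?m"
    proof -
      have "emeasure P (space P) = (\<integral>\<^sup>+ u. cmod (\<Phi> u) \<partial>M)"
        unfolding P_def by (simp add: emeasure_density cong: nn_integral_cong)
      also have "\<dots> = ennreal ?m" using \<Phi> by (intro nn_integral_eq_integral) simp_all
      finally show ?thesis by (simp add: measure_def)
    qed
    have plus: "AE u in P. A u \<in> aut_plus r"
      unfolding P_def using assms(6) by (subst AE_density) auto
    have polar: "cmod (\<Phi> u) *\<^sub>R (sgn (\<Phi> u) * z) = \<Phi> u * z" for u z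
      by (simp add: scaleR_conv_of_real sgn_eq)
    have meas: "(\<lambda>u. sgn (\<Phi> u) * \<phi> (A u x)) \<in> borel_measurable M"
      if [measurable]: "\<phi> \<in> borel_measurable borel" for \<phi> x
    proof -
      have "(\<lambda>u. sgn (\<Phi> u) * \<phi> (A u x)) \<in> borel_measurable P" by simp
      then show ?thesis unfolding P_def by simp
    qed
    have haus: "hausdorff M \<Phi> A \<phi> = avg \<phi>" if "\<phi> \<in> borel_measurable borel" for \<phi>
    proof
      fix x
      show "hausdorff M \<Phi> A \<phi> x = avg \<phi> x"
        unfolding hausdorff_def avg_def unfolding P_def
        using integral_density[OF meas[OF that, of x], of "\<lambda>u. cmod (\<Phi> u)"] by (simp add: polar)
    qed
    have int: "integrable M (\<lambda>u. \<Phi> u * \<phi> (A u x)) \<longleftrightarrow> integrable P (\<lambda>u. sgn (\<Phi> u) * \<phi> (A u x))"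
      if "\<phi> \<in> borel_measurable borel" for \<phi> x
      unfolding P_def
      using integrable_density[OF meas[OF that, of x], of "\<lambda>u. cmod (\<Phi> u)"] by (simp add: polar)
    have BMOm: "\<phi> \<in> borel_measurable borel" if "\<phi> \<in> BMO \<nu> r" for \<phi>
      using that unfolding BMO_def by simp
    note bd = BMO_avg[OF assms(4) plus, unfolded m]
    have "hausdorff_bounded_on \<nu> M \<Phi> A (BMO \<nu> r) (BMO_norm \<nu> r)"
      unfolding hausdorff_bounded_on_def
    proof (intro conjI ballI impI exI)
      fix f assume f: "f \<in> BMO \<nu> r"
      show "AE x in \<nu>. integrable M (\<lambda>u. \<Phi> u * f (A u x))"
        unfolding int[OF BMOm[OF f]] by (rule bd(1)[OF f])
      show "\<exists>g\<in>BMO \<nu> r. AE x in \<nu>. hausdorff M \<Phi> A f x = g x"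
        unfolding haus[OF BMOm[OF f]] by (rule bd(2)[OF f])
      show "BMO_norm \<nu> r (hausdorff M \<Phi> A f) \<le> ?m * BMO_norm \<nu> r f"
        unfolding haus[OF BMOm[OF f]] by (rule bd(3)[OF f])
      fix g assume g: "g \<in> BMO \<nu> r" and "AE x in \<nu>. f x = g x"
      then show "AE x in \<nu>. hausdorff M \<Phi> A f x = hausdorff M \<Phi> A g x"
        unfolding haus[OF BMOm[OF f]] haus[OF BMOm[OF g]]
        by (intro avg_AE_cong BMOm f g)
    qed
    moreover have "hausdorff_op_norm M \<Phi> A (BMO \<nu> r) (BMO_norm \<nu> r) \<le> ?m"
      unfolding hausdorff_op_norm_def
    proof (rule cSup_least)
      have "BMO_norm \<nu> r (\<lambda>x. 0) \<le> 1" using const_in_BMO(2)[of r 0] by simp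
      then show "{BMO_norm \<nu> r (hausdorff M \<Phi> A f) |f. f \<in> BMO \<nu> r \<and> BMO_norm \<nu> r f \<le> 1} \<noteq> {}"
        using const_in_BMO(1)[of 0 r] by blast
      fix t assume "t \<in> {BMO_norm \<nu> r (hausdorff M \<Phi> A f) |f. f \<in> BMO \<nu> r \<and> BMO_norm \<nu> r f \<le> 1}"
      then obtain f where f: "f \<in> BMO \<nu> r" "BMO_norm \<nu> r f \<le> 1" and t: "t = BMO_norm \<nu> r (hausdorff M \<Phi> A f)"
        by blast
      have "t \<le> ?m * BMO_norm \<nu> r f" unfolding t haus[OF BMOm[OF f(1)]] by (rule bd(3)[OF f(1)])
      also have "\<dots> \<le> ?m * 1" by (rule mult_left_mono[OF f(2)]) simp
      finally show "t \<le> ?m" by simp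
    qed
    ultimately show ?thesis ..
  qed
  show ?thesis using necessary sufficient by (intro conjI iffI impI) simp_all
qed

end
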